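(* Let $n\ge 3$, $0<m<\frac{n-2}{n}$, $\lambda>0$, $A>0$, $\beta<0$, $\alpha=\frac{2\beta}{1-m}$, $\widetilde\beta=-\beta$. Let $\gamma_1, a_1, K_0, a_3(\cdot,\cdot)$ be the constants, and $f_{\beta,A}$, $f_\lambda$ the functions, defined in the context. Then $$f_{\beta,A}^{1-m}(r)=\frac{2(n-1)(n-2-nm)}{(1-m)|\beta| r^2}\Big\{\log r^{-1}+\frac{n-2-(n+2)m}{2(n-2-nm)}\log(\log r^{-1})+K_0+\frac{1}{\gamma_1}\log A+\frac{m}{n-2-nm}\log|\beta|+\frac{a_3(A,\widetilde\beta)}{\log r^{-1}}+\frac{(n-2-(n+2)m)^2}{4(n-2-nm)^2}\cdot\frac{\log(\log r^{-1})}{\log r^{-1}}+o\Big(\frac{1}{\log r^{-1}}\Big)\Big\}$$ as $r\to 0$, and $$f_{\lambda}^{1-m}(r)=\frac{2(n-1)(n-2-nm)}{(1-m)|\beta| r^2}\Big\{\log r^{-1}+\frac{n-2-(n+2)m}{2(n-2-nm)}\log(\log r^{-1})+K_0-\log\lambda+\frac{m}{n-2-nm}\log|\beta|+\frac{a_3(\lambda^{-\gamma_1},\widetilde\beta)}{\log r^{-1}}+\frac{(n-2-(n+2)m)^2}{4(n-2-nm)^2}\cdot\frac{\log(\log r^{-1})}{\log r^{-1}}+o\Big(\frac{1}{\log r^{-1}}\Big)\Big\}$$ as $r\to 0$.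
   Context: The functions $f_{\beta,A}$ and $f_\lambda$. For $\beta<0$, $\alpha=\frac{2\beta}{1-m}$ and $A>0$, $f_{\beta,A}$ denotes the unique positive solution on $(0,\infty)$ of $$\frac{n-1}{m}\left((f^m)_{rr}+\frac{n-1}{r}(f^m)_r\right)+\alpha f+\beta r f_r=0$$ with $\lim_{r\to\infty}r^{\frac{n-2}{m}}f(r)=A$ (it exists and is unique). Put $f_1=f_{\beta,1}$ and $f_\lambda(r)=\lambda^{\frac{2}{1-m}}f_1(\lambda r)$ for $\lambda>0$. The function $g_{\widetilde\beta,\eta}$. For $\widetilde\beta>0$, $\eta>0$ set $\widetilde\alpha=\widetilde\beta\left(\frac{n-2}{m}-\frac{2}{1-m}\right)$. Let $g=g_{\widetilde\beta,\eta}$ be the unique positive solution on $(0,\infty)$ of $$\frac{n-1}{m}\left((g^m)_{rr}+\frac{n-1}{r}(g^m)_r\right)+r^{\frac{n-2}{m}-n-2}\left(\widetilde\alpha g+\widetilde\beta r g_r\right)=0,\qquad g(0)=\eta,$$ where: if $0<m<\frac{n-2}{n+1}$, $g\in C^1([0,\infty))\cap C^2((0,\infty))$ and $g_r(0)=0$; if $\frac{n-2}{n+1}\le m<\frac{n-2}{n}$, $g\in C^{0,\delta_0}([0,\infty))\cap C^2((0,\infty))$ and $\lim_{r\to0^+}r^{\delta_1}g_r(r)=-\frac{\widetilde\alpha\eta^{2-m}}{n-2-2m}$, with $\delta_1=1-\frac{n-2-nm}{m}$, $\delta_0=\frac{1-\delta_1}{2}$. (It is known that $g$ exists and is unique.)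 Let $\widetilde w(s)=e^{(1-m)\frac{\widetilde\alpha}{\widetilde\beta}s}g(e^s)^{1-m}$ for $s\in\mathbb{R}$, and $$h(s)=\widetilde w(s)-\frac{2(n-1)(n-2-nm)}{(1-m)\widetilde\beta}s,\qquad h_1(s)=h(s)-\frac{(n-1)(n-2-(n+2)m)}{(1-m)\widetilde\beta}\log s .$$ The constants. $K(\eta,\widetilde\beta)=\lim_{s\to\infty}h_1(s)$ if $m\ne\frac{n-2}{n+2}$, and $K(\eta,\widetilde\beta)=\lim_{s\to\infty}h(s)$ if $m=\frac{n-2}{n+2}$ (these limits exist and are finite). Further, $$\gamma_1=\frac{n-2}{m}-\frac{2}{1-m}=\frac{n-2-nm}{m(1-m)}>0,\qquad K_0=\frac{(1-m)K(1,1)}{2(n-1)(n-2-nm)},$$ $$a_2(\eta,\widetilde\beta)=\frac{2(1-2m)(n-1)(n-2-nm)}{(1-m)^2}+\frac{(n-1)(n-2-(n+2)m)^2}{(1-m)^2}-\frac{n-2-(n+2)m}{1-m}K(\eta,\widetilde\beta)\widetilde\beta,$$ $$a_1=\frac{(n-2-(n+2)m)^2}{4(n-2-nm)^2}-\frac{(1-m)^2a_2(1,1)}{4(n-1)(n-2-nm)^2},$$ $$a_3(A,\widetilde\beta)=a_1+\frac{n-2-(n+2)m}{2(n-2-nm)\gamma_1}\log\left(A\widetilde\beta^{\frac{1}{1-m}}\right).$$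
   Formalization: For (n-2)/(n+1) ≤ m < (n-2)/n the limit of r^{δ1} g_r at 0 is taken as -(m/(n-1)) α̃ η^{2-m}/(n-2-2m): the printed limit lacks the factor m/(n-1), which the equation for g forces, so no such g would exist and K_0, a_1, a_3 would be undefined. *)

theory Defs
  imports "HOL-Analysis.Analysis" "HOL-Library.Landau_Symbols"
begin

definition C2_pos :: "(real \<Rightarrow> real) \<Rightarrow> bool" where
  "C2_pos u \<longleftrightarrow>
     (\<forall>r>0. u differentiable (at r) \<and> deriv u differentiable (at r)) \<and>
     continuous_on {0<..} (deriv (deriv u))"

text \<open>The term \<open>(n-1)/m ((u\<^sup>m)\<^sub>r\<^sub>r + (n-1)/r (u\<^sup>m)\<^sub>r)\<close> common to both equations.\<close>

definition fde_op :: "nat \<Rightarrow> real \<Rightarrow> (real \<Rightarrow> real) \<Rightarrow> real \<Rightarrow> real" where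
  "fde_op n m u r =
     (real n - 1) / m *
       (deriv (deriv (\<lambda>x. u x powr m)) r + (real n - 1) / r * deriv (\<lambda>x. u x powr m) r)"

text \<open>\<open>is_f n m \<beta> A f\<close> says that \<open>f\<close> restricted to \<open>(0,\<infinity>)\<close> is the solution \<open>f\<^bsub>\<beta>,A\<^esub>\<close>;
  nothing is required of the values of \<open>f\<close> outside \<open>(0,\<infinity>)\<close>.\<close>

definition is_f :: "nat \<Rightarrow> real \<Rightarrow> real \<Rightarrow> real \<Rightarrow> (real \<Rightarrow> real) \<Rightarrow> bool" where
  "is_f n m \<beta> A f \<longleftrightarrow>
     (let \<alpha> = 2 * \<beta> / (1 - m) in
        C2_pos f \<and> (\<forall>r>0. f r > 0) \<and>
        (\<forall>r>0. fde_op n m f r + \<alpha> * f r + \<beta> * r * deriv f r = 0) \<and>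
        ((\<lambda>r. r powr ((real n - 2) / m) * f r) \<longlongrightarrow> A) at_top)"

definition f_scaled :: "real \<Rightarrow> real \<Rightarrow> (real \<Rightarrow> real) \<Rightarrow> real \<Rightarrow> real" where
  "f_scaled m lam f1 r = lam powr (2 / (1 - m)) * f1 (lam * r)"

definition gamma1 :: "nat \<Rightarrow> real \<Rightarrow> real" where
  "gamma1 n m = (real n - 2) / m - 2 / (1 - m)"

definition alpha_t :: "nat \<Rightarrow> real \<Rightarrow> real \<Rightarrow> real" where
  "alpha_t n m \<beta>t = \<beta>t * ((real n - 2) / m - 2 / (1 - m))"

definition delta1 :: "nat \<Rightarrow> real \<Rightarrow> real" where
  "delta1 n m = 1 - (real n - 2 - real n * m) / m"

definition delta0 :: "nat \<Rightarrow> real \<Rightarrow> real" where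
  "delta0 n m = (1 - delta1 n m) / 2"

definition holder_on :: "real \<Rightarrow> real set \<Rightarrow> (real \<Rightarrow> real) \<Rightarrow> bool" where
  "holder_on \<delta> S u \<longleftrightarrow> (\<exists>C. \<forall>x\<in>S. \<forall>y\<in>S. \<bar>u x - u y\<bar> \<le> C * \<bar>x - y\<bar> powr \<delta>)"

text \<open>For \<open>m \<ge> (n-2)/(n+1)\<close> the behaviour of \<open>g\<^sub>r\<close> at \<open>0\<close> is prescribed with the factor
  \<open>m/(n-1)\<close>. It is forced by the equation: since
  \<open>((n-1)/m) (r\<^sup>n\<^sup>-\<^sup>1 (g\<^sup>m)\<^sub>r)\<^sub>r = - r\<^bsup>(n-2)/m-3\<^esup> (\<alpha>t g + \<beta>t r g\<^sub>r)\<close>,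
  integrating from \<open>0\<close> and using \<open>g(0) = \<eta>\<close> gives
  \<open>(n-1) \<eta>\<^bsup>m-1\<^esup> r\<^bsup>\<delta>1\<^esup> g\<^sub>r \<longlongrightarrow> - \<alpha>t \<eta> m / (n-2-2m)\<close>.
  The literature also states the limit without the factor \<open>m/(n-1)\<close>, which no solution
  of the equation with the coefficient \<open>(n-1)/m\<close> satisfies.\<close>

definition is_g :: "nat \<Rightarrow> real \<Rightarrow> real \<Rightarrow> real \<Rightarrow> (real \<Rightarrow> real) \<Rightarrow> bool" where
  "is_g n m \<beta>t \<eta> g \<longleftrightarrow>
     C2_pos g \<and> (\<forall>r>0. g r > 0) \<and>
     (\<forall>r>0. fde_op n m g r +
        r powr ((real n - 2) / m - real n - 2) *
          (alpha_t n m \<beta>t * g r + \<beta>t * r * deriv g r) = 0) \<and>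
     g 0 = \<eta> \<and>
     (if m < (real n - 2) / (real n + 1)
      then (\<exists>g'. continuous_on {0..} g' \<and> g' 0 = 0 \<and>
              (\<forall>r\<ge>0. (g has_real_derivative g' r) (at r within {0..})))
      else holder_on (delta0 n m) {0..} g \<and>
           ((\<lambda>r. r powr delta1 n m * deriv g r) \<longlongrightarrow>
              - (m / (real n - 1)) * (alpha_t n m \<beta>t * \<eta> powr (2 - m) / (real n - 2 - 2 * m)))
             (at_right 0))"

text \<open>The values on \<open>(-\<infinity>,0)\<close> are set to \<open>0\<close> so that the description is unique.\<close>

definition g_sol :: "nat \<Rightarrow> real \<Rightarrow> real \<Rightarrow> real \<Rightarrow> real \<Rightarrow> real" where
  "g_sol n m \<beta>t \<eta> = (THE g. is_g n m \<beta>t \<eta> g \<and> (\<forall>r<0. g r = 0))"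

definition w_t :: "nat \<Rightarrow> real \<Rightarrow> real \<Rightarrow> real \<Rightarrow> real \<Rightarrow> real" where
  "w_t n m \<eta> \<beta>t s =
     exp ((1 - m) * (alpha_t n m \<beta>t / \<beta>t) * s) * g_sol n m \<beta>t \<eta> (exp s) powr (1 - m)"

definition h0 :: "nat \<Rightarrow> real \<Rightarrow> real \<Rightarrow> real \<Rightarrow> real \<Rightarrow> real" where
  "h0 n m \<eta> \<beta>t s =
     w_t n m \<eta> \<beta>t s
       - 2 * (real n - 1) * (real n - 2 - real n * m) / ((1 - m) * \<beta>t) * s"

definition h1 :: "nat \<Rightarrow> real \<Rightarrow> real \<Rightarrow> real \<Rightarrow> real \<Rightarrow> real" where
  "h1 n m \<eta> \<beta>t s =
     h0 n m \<eta> \<beta>t s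
       - (real n - 1) * (real n - 2 - (real n + 2) * m) / ((1 - m) * \<beta>t) * ln s"

definition K :: "nat \<Rightarrow> real \<Rightarrow> real \<Rightarrow> real \<Rightarrow> real" where
  "K n m \<eta> \<beta>t =
     (if m \<noteq> (real n - 2) / (real n + 2) then Lim at_top (h1 n m \<eta> \<beta>t)
      else Lim at_top (h0 n m \<eta> \<beta>t))"

definition K0 :: "nat \<Rightarrow> real \<Rightarrow> real" where
  "K0 n m = (1 - m) * K n m 1 1 / (2 * (real n - 1) * (real n - 2 - real n * m))"

definition a2 :: "nat \<Rightarrow> real \<Rightarrow> real \<Rightarrow> real \<Rightarrow> real" where
  "a2 n m \<eta> \<beta>t =
     2 * (1 - 2 * m) * (real n - 1) * (real n - 2 - real n * m) / (1 - m)\<^sup>2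
     + (real n - 1) * (real n - 2 - (real n + 2) * m)\<^sup>2 / (1 - m)\<^sup>2
     - (real n - 2 - (real n + 2) * m) / (1 - m) * K n m \<eta> \<beta>t * \<beta>t"

definition a1 :: "nat \<Rightarrow> real \<Rightarrow> real" where
  "a1 n m =
     (real n - 2 - (real n + 2) * m)\<^sup>2 / (4 * (real n - 2 - real n * m)\<^sup>2)
     - (1 - m)\<^sup>2 * a2 n m 1 1 / (4 * (real n - 1) * (real n - 2 - real n * m)\<^sup>2)"

definition a3 :: "nat \<Rightarrow> real \<Rightarrow> real \<Rightarrow> real \<Rightarrow> real" where
  "a3 n m A \<beta>t =
     a1 n m
     + (real n - 2 - (real n + 2) * m) / (2 * (real n - 2 - real n * m) * gamma1 n m)
         * ln (A * \<beta>t powr (1 / (1 - m)))"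

end

theory Submission
  imports Defs
begin

text \<open>The inversion \<open>g(r) = r\<^bsup>-(n-2)/m\<^esup> f(1/r)\<close> turns \<open>f\<^bsub>\<beta>,A\<^esub>\<close> into a solution of the \<open>g\<close>-equation with
  value \<open>A\<close> at \<open>0\<close>. A flux argument at \<open>0\<close> gives the prescribed regularity of \<open>g\<close>, and a weighted
  supremum norm gives uniqueness; since \<open>f\<^bsub>\<beta>,A\<^esub>\<close> rescales to \<open>f\<^bsub>-1,1\<^esub>\<close>, this identifies
  \<open>g\<^bsub>1,1\<^esub>\<close> without any existence theory.

  In the variable \<open>s = log (1/r)\<close> the function \<open>w(s) = r\<^sup>2 f\<^bsup>1-m\<^esup>\<close> and its logarithmic derivative
  \<open>y\<close> solve the autonomous system \<open>w' = w y\<close>, \<open>y' = 2a + b y - p y\<^sup>2 - B w y\<close> with \<open>y\<close> positive and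
  bounded. Each of \<open>y\<close>, \<open>w y\<close>, \<open>w (w' - c)\<close>, \<open>w (w (w' - c) - \<kappa> c)\<close> then satisfies \<open>x' = R - B w x\<close> with
  \<open>w \<longrightarrow> \<infinity>\<close>, so it tends to \<open>lim R / (B w)\<close>; this yields
  \<open>w' = c + \<kappa> c / w + (D2 + o(1)) / w\<^sup>2\<close> and, by integration, the expansion of \<open>w\<close>. The dependence of the
  constants on \<open>A\<close> and \<open>\<beta>\<close> comes from the translation of \<open>s\<close> that corresponds to the rescaling.\<close>

section \<open>Limits of scalar differential equations\<close>

text \<open>The constants \<open>K0\<close>, \<open>a1\<close> and \<open>a3\<close> refer to one
  solution, \<open>g_sol n m 1 1\<close>, given by a definite description, while the hypotheses
  supply only \<open>f\<close> and \<open>f1\<close>. So the inverted and rescaled \<open>f\<close>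
  must be shown to meet every clause of \<open>is_g\<close>, and any other candidate to agree with
  it. All that is known of the inverted function at 0 is its limit, not its derivative; the
  regularity has to be extracted from the equation.

  The shape of \<open>a3\<close> comes from the normalised expansion. After division by the slope
  \<open>c\<close> the coefficient \<open>B\<close> disappears, and the coefficient of
  \<open>1/s\<close> is affine in the constant term, with linear coefficient \<rho> equal to that of
  \<open>ln s\<close>. Hence \<open>A\<close> and \<beta> enter only through the constant term, and
  its value \<open>K0\<close> for one pair of parameters is enough: a translation that adds
  \<open>L\<close> to it adds \<rho> times \<open>L\<close> to the coefficient of
  \<open>1/s\<close>, which is the step from \<open>a1\<close> to \<open>a3\<close>.

  The corrections of \<open>w'\<close> are measured in powers of \<open>w\<close> rather than
  \<open>s\<close> because the equations of the remainders then stay exact and of one form.\<close>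

lemma tendsto_relaxation:
  fixes q P R :: "real \<Rightarrow> real"
  assumes q: "\<And>s. s \<ge> s0 \<Longrightarrow> (q has_real_derivative R s - P s * q s) (at s)"
    and P: "continuous_on {s0..} P" "filterlim P at_top at_top"
    and R: "((\<lambda>s. R s / P s) \<longlongrightarrow> l) at_top"
  shows "(q \<longlongrightarrow> l) at_top"
proof -
  define \<Phi> where "\<Phi> s = integral {s0..s} P" for s
  have D\<Phi>: "(\<Phi> has_real_derivative P s) (at s)" if "s > s0" for s
  proof -
    have "continuous_on {s0..s+1} P" by (rule continuous_on_subset[OF P(1)]) auto
    then have "(\<Phi> has_real_derivative P s) (at s within {s0..s+1})"
      unfolding \<Phi>_def using that by (intro integral_has_real_derivative) auto
    then have "(\<Phi> has_real_derivative P s) (at s within {s0<..<s+1})"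
      by (rule DERIV_subset) auto
    then show ?thesis using that by (simp add: at_within_open[of s "{s0<..<s+1}"])
  qed
  have "eventually (\<lambda>s. P s \<ge> 1) at_top"
    using P(2) by (auto simp: filterlim_at_top)
  then obtain N where N: "\<And>s. s \<ge> N \<Longrightarrow> P s \<ge> 1" by (auto simp: eventually_at_top_linorder)
  define s1 where "s1 = max N (s0 + 1)"
  have ge: "\<Phi> s \<ge> \<Phi> s1 + (s - s1)" if "s \<ge> s1" for s
  proof -
    have "\<Phi> s1 - s1 \<le> \<Phi> s - s"
    proof (rule DERIV_nonneg_imp_nondecreasing[OF that])
      fix x assume "s1 \<le> x" "x \<le> s"
      then have "((\<lambda>s. \<Phi> s - s) has_real_derivative P x - 1) (at x)" "P x - 1 \<ge> 0"
        using N[of x] by (auto intro!: derivative_intros D\<Phi> simp: s1_def)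
      then show "\<exists>y. ((\<lambda>s. \<Phi> s - s) has_real_derivative y) (at x) \<and> y \<ge> 0" by blast
    qed
    then show ?thesis by simp
  qed
  have "filterlim (\<lambda>s. (\<Phi> s1 - s1) + s) at_top at_top"
    by (intro filterlim_tendsto_add_at_top[OF tendsto_const] filterlim_ident)
  then have "filterlim \<Phi> at_top at_top"
    by (rule filterlim_at_top_mono)
       (use ge in \<open>auto simp: eventually_at_top_linorder intro!: exI[of _ s1] simp: algebra_simps\<close>)
  then have E: "filterlim (\<lambda>s. exp (\<Phi> s)) at_top at_top"
    by (rule filterlim_compose[OF exp_at_top])
  \<comment> \<open>With the integrating factor \<open>exp \<Phi>\<close>, the derivatives of
    numerator and denominator are \<open>R exp \<Phi>\<close> and \<open>P exp \<Phi>\<close>. This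
    form of l'Hospital's rule asks only that the denominator diverge, so no a priori bound on
    \<open>q\<close> has to be found.\<close>
  have "((\<lambda>s. (q s * exp (\<Phi> s)) / exp (\<Phi> s)) \<longlongrightarrow> l) at_top"
  proof (rule lhospital_at_top_at_top[OF E])
    show "\<forall>\<^sub>F x in at_top. exp (\<Phi> x) * P x \<noteq> 0"
      using eventually_ge_at_top[of N] by eventually_elim (use N in force)
    show "\<forall>\<^sub>F x in at_top. ((\<lambda>s. q s * exp (\<Phi> s)) has_real_derivative exp (\<Phi> x) * R x) (at x)"
      using eventually_gt_at_top[of s0]
      by eventually_elim (auto intro!: derivative_eq_intros q D\<Phi> simp: algebra_simps)
    show "\<forall>\<^sub>F x in at_top. ((\<lambda>s. exp (\<Phi> s)) has_real_derivative exp (\<Phi> x) * P x) (at x)"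
      using eventually_gt_at_top[of s0]
      by eventually_elim (auto intro!: derivative_eq_intros q D\<Phi>)
    show "((\<lambda>x. exp (\<Phi> x) * R x / (exp (\<Phi> x) * P x)) \<longlongrightarrow> l) at_top"
      using R by simp
  qed
  then show ?thesis by simp
qed

text \<open>For every positive \<open>e\<close>, eventually \<open>H + (M - e)/s\<close> increases
  and \<open>H + (M + e)/s\<close> decreases, which squeezes the increments of \<open>H\<close>
  between multiples of \<open>1/s - 1/t\<close>. This replaces an integration of
  \<open>H'\<close>.\<close>

lemma tendsto_remainder_of_deriv:
  fixes H H' :: "real \<Rightarrow> real"
  assumes H: "\<And>s. s \<ge> s0 \<Longrightarrow> (H has_real_derivative H' s) (at s)"
    and lim: "((\<lambda>s. s\<^sup>2 * H' s) \<longlongrightarrow> M) at_top"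
  obtains L where "(H \<longlongrightarrow> L) at_top" "((\<lambda>s. s * (H s - L)) \<longlongrightarrow> - M) at_top"
proof -
  have mono: "\<exists>N>0. \<forall>s\<ge>N. \<forall>t\<ge>s. H t - H s \<le> (M + e) * (1/s - 1/t) \<and> H t - H s \<ge> (M - e) * (1/s - 1/t)"
    if "e > 0" for e
  proof -
    have "eventually (\<lambda>s. dist (s\<^sup>2 * H' s) M < e) at_top" using lim that by (simp add: tendsto_iff)
    then obtain N0 where N0: "\<And>s. s \<ge> N0 \<Longrightarrow> dist (s\<^sup>2 * H' s) M < e"
      by (auto simp: eventually_at_top_linorder)
    define N where "N = max (max N0 1) s0"
    have bd: "(M - e) / s\<^sup>2 \<le> H' s" "H' s \<le> (M + e) / s\<^sup>2" if "s \<ge> N" for s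
    proof -
      have "s > 0" "dist (s\<^sup>2 * H' s) M < e" using that N0 by (auto simp: N_def)
      then show "(M - e) / s\<^sup>2 \<le> H' s" "H' s \<le> (M + e) / s\<^sup>2"
        by (auto simp: dist_real_def field_simps abs_if split: if_splits)
    qed
    have "H t - H s \<le> (M + e) * (1/s - 1/t) \<and> H t - H s \<ge> (M - e) * (1/s - 1/t)"
      if "s \<ge> N" "t \<ge> s" for s t
    proof -
      have "H s + (M - e) / s \<le> H t + (M - e) / t"
      proof (rule DERIV_nonneg_imp_nondecreasing[OF \<open>t \<ge> s\<close>])
        fix x assume "s \<le> x" "x \<le> t"
        then have "x \<ge> N" "x \<ge> s0" "x > 0" using that by (auto simp: N_def)
        then have "((\<lambda>s. H s + (M - e) / s) has_real_derivative H' x - (M - e) / x\<^sup>2) (at x)"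
          by (auto intro!: derivative_eq_intros H simp: power2_eq_square field_simps)
        then show "\<exists>y. ((\<lambda>s. H s + (M - e) / s) has_real_derivative y) (at x) \<and> y \<ge> 0"
          using bd[OF \<open>x \<ge> N\<close>] by (intro exI conjI) auto
      qed
      moreover have "H s + (M + e) / s \<ge> H t + (M + e) / t"
      proof (rule DERIV_nonpos_imp_nonincreasing[OF \<open>t \<ge> s\<close>])
        fix x assume "s \<le> x" "x \<le> t"
        then have "x \<ge> N" "x \<ge> s0" "x > 0" using that by (auto simp: N_def)
        then have "((\<lambda>s. H s + (M + e) / s) has_real_derivative H' x - (M + e) / x\<^sup>2) (at x)"
          by (auto intro!: derivative_eq_intros H simp: power2_eq_square field_simps)
        then show "\<exists>y. ((\<lambda>s. H s + (M + e) / s) has_real_derivative y) (at x) \<and> y \<le> 0"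
          using bd[OF \<open>x \<ge> N\<close>] by (intro exI conjI) auto
      qed
      ultimately show ?thesis by (simp add: algebra_simps)
    qed
    moreover have "N > 0" by (simp add: N_def)
    ultimately show ?thesis by blast
  qed
  have "\<exists>L. (H \<longlongrightarrow> L) at_top"
  proof -
    obtain N where N: "N > 0" "\<And>s t. s \<ge> N \<Longrightarrow> t \<ge> s \<Longrightarrow> H t - H s \<le> (M + 1) * (1/s - 1/t)"
       "\<And>s t. s \<ge> N \<Longrightarrow> t \<ge> s \<Longrightarrow> H t - H s \<ge> (M - 1) * (1/s - 1/t)"
      using mono[of 1] by auto
    \<comment> \<open>The limit of \<open>H\<close> exists because \<open>G\<close> is decreasing
      and bounded below and \<open>G - H\<close> vanishes at infinity.\<close>
    define G where "G s = H s + (M + 1) / s" for s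
    have dec: "G t \<le> G s" if "s \<ge> N" "t \<ge> s" for s t
      using N(2)[OF that] by (simp add: G_def algebra_simps)
    have bdd: "G t \<ge> H N + (M - 1)/N" if "t \<ge> N" for t
    proof -
      have "0 \<le> 1/t" using N(1) that by (auto simp: field_simps)
      moreover have "(M - 1) * (1/N - 1/t) = (M - 1)/N - (M - 1)/t" by (simp add: right_diff_distrib)
      moreover have "(M + 1)/t = (M - 1)/t + 2 * (1/t)"
        by (simp add: add_divide_distrib diff_divide_distrib)
      ultimately show ?thesis using N(3)[OF order_refl that] unfolding G_def by linarith
    qed
    have bb: "bdd_below (G ` {N..})" using bdd by (intro bdd_belowI2) auto
    have "(G \<longlongrightarrow> Inf (G ` {N..})) at_top"
    proof (rule decreasing_tendsto)
      show "\<forall>\<^sub>F x in at_top. Inf (G ` {N..}) \<le> G x"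
        using eventually_ge_at_top[of N] by eventually_elim (auto intro!: cINF_lower bb)
      fix x assume "Inf (G ` {N..}) < x"
      then obtain s where "s \<ge> N" "G s < x" using cInf_lessD[of "G ` {N..}" x] by auto
      then show "\<forall>\<^sub>F t in at_top. G t < x"
        using dec[of s] by (force simp: eventually_at_top_linorder intro!: exI[of _ s])
    qed
    moreover have "((\<lambda>s::real. (M + 1) / s) \<longlongrightarrow> 0) at_top"
      by (intro tendsto_divide_0[OF tendsto_const] filterlim_at_top_imp_at_infinity filterlim_ident)
    ultimately have "((\<lambda>s. G s - (M + 1) / s) \<longlongrightarrow> Inf (G ` {N..}) - 0) at_top"
      by (rule tendsto_diff)
    then show ?thesis by (auto simp: G_def)
  qed
  then obtain L where L: "(H \<longlongrightarrow> L) at_top" by blast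
  have "((\<lambda>s. s * (H s - L)) \<longlongrightarrow> - M) at_top"
  proof (rule tendstoI)
    fix e :: real assume "e > 0"
    then obtain N where N: "N > 0" "\<And>s t. s \<ge> N \<Longrightarrow> t \<ge> s \<Longrightarrow> H t - H s \<le> (M + e/2) * (1/s - 1/t)"
       "\<And>s t. s \<ge> N \<Longrightarrow> t \<ge> s \<Longrightarrow> H t - H s \<ge> (M - e/2) * (1/s - 1/t)"
      using mono[of "e/2"] by auto
    have it: "((\<lambda>t. 1/s - 1/t) \<longlongrightarrow> 1/s - 0) at_top" for s :: real
      by (intro tendsto_intros tendsto_divide_0[OF tendsto_const] filterlim_at_top_imp_at_infinity filterlim_ident)
    have "dist (s * (H s - L)) (- M) < e" if s: "s \<ge> N" for s
    proof -
      have "L - H s \<le> (M + e/2) * (1/s - 0)"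
        by (rule tendsto_le[OF _ tendsto_mult[OF tendsto_const it] tendsto_diff[OF L tendsto_const]])
           (use N(2)[OF s] in \<open>auto simp: eventually_at_top_linorder\<close>)
      moreover have "L - H s \<ge> (M - e/2) * (1/s - 0)"
        by (rule tendsto_le[OF _ tendsto_diff[OF L tendsto_const] tendsto_mult[OF tendsto_const it]])
           (use N(3)[OF s] in \<open>auto simp: eventually_at_top_linorder\<close>)
      moreover have "s > 0" using s N(1) by simp
      ultimately have "s * (L - H s) \<le> M + e/2" "s * (L - H s) \<ge> M - e/2"
        by (auto simp: field_simps)
      then have "\<bar>s * (H s - L) + M\<bar> \<le> e/2" by (intro abs_leI) (auto simp: algebra_simps)
      then show ?thesis using \<open>e > 0\<close> by (simp add: dist_real_def)
    qed
    then show "\<forall>\<^sub>F s in at_top. dist (s * (H s - L)) (- M) < e"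
      by (auto simp: eventually_at_top_linorder)
  qed
  with L show ?thesis by (rule that)
qed

section \<open>Asymptotics of the autonomous system\<close>

locale wy_system =
  fixes w y :: "real \<Rightarrow> real" and a b p B Y :: real
  assumes a: "a > 0" and B: "B > 0"
    and Dw: "\<And>s. (w has_real_derivative w s * y s) (at s)"
    and Dy: "\<And>s. (y has_real_derivative 2 * a + b * y s - p * (y s)\<^sup>2 - B * w s * y s) (at s)"
    and w_pos: "\<And>s. w s > 0" and y_pos: "\<And>s. y s > 0" and y_le: "\<And>s. y s \<le> Y"
begin

lemma w_mono: "s \<le> t \<Longrightarrow> w s \<le> w t"
  by (erule DERIV_nonneg_imp_nondecreasing, rule exI, rule conjI, rule Dw)
     (intro mult_nonneg_nonneg less_imp_le w_pos y_pos)

text \<open>A bounded \<open>w\<close> would give \<open>y' \<ge> 2 a - C y\<close>. Since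
  \<open>y\<close> is the derivative of \<open>ln w\<close>, the function
  \<open>y + C ln w - 2 a s\<close> would then be nondecreasing, although its first two terms stay
  bounded above.\<close>

lemma w_at_top: "filterlim w at_top at_top"
proof -
  have "\<exists>s. w s > L" for L
  proof (rule ccontr)
    assume "\<not> ?thesis"
    then have wL: "w s \<le> L" for s by (auto simp: not_less)
    define C where "C = \<bar>b\<bar> + \<bar>p\<bar> * Y + B * L"
    have ge: "2 * a + b * y x - p * (y x)\<^sup>2 - B * w x * y x \<ge> 2 * a - C * y x" for x
    proof -
      have "b * y x \<ge> - \<bar>b\<bar> * y x"
        using mult_right_mono[OF abs_ge_minus_self[of b] less_imp_le[OF y_pos[of x]]] by simp
      moreover have "p * (y x)\<^sup>2 \<le> \<bar>p\<bar> * Y * y x"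
      proof -
        have "p * (y x)\<^sup>2 \<le> \<bar>p\<bar> * (y x)\<^sup>2" by (intro mult_right_mono) auto
        also have "\<dots> \<le> \<bar>p\<bar> * (Y * y x)"
          using y_pos[of x] y_le[of x] by (intro mult_left_mono) (auto simp: power2_eq_square)
        finally show ?thesis by (simp add: mult_ac)
      qed
      moreover have "B * w x * y x \<le> B * L * y x"
        using y_pos[of x] B wL[of x] by (intro mult_right_mono mult_left_mono) auto
      ultimately show ?thesis by (simp add: C_def algebra_simps)
    qed
    have inc: "y 0 + C * ln (w 0) - 2 * a * 0 \<le> y s + C * ln (w s) - 2 * a * s" if "s \<ge> 0" for s
    proof (rule DERIV_nonneg_imp_nondecreasing[OF that])
      fix x
      have "((\<lambda>s. y s + C * ln (w s) - 2 * a * s) has_real_derivative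
          (2 * a + b * y x - p * (y x)\<^sup>2 - B * w x * y x) + C * y x - 2 * a) (at x)"
        using w_pos[of x] by (auto intro!: derivative_eq_intros Dw Dy)
      moreover have "(2 * a + b * y x - p * (y x)\<^sup>2 - B * w x * y x) + C * y x - 2 * a \<ge> 0"
        using ge[of x] by simp
      ultimately show "\<exists>d. ((\<lambda>s. y s + C * ln (w s) - 2 * a * s) has_real_derivative d) (at x) \<and> d \<ge> 0"
        by blast
    qed
    have "Y > 0" using y_pos[of 0] y_le[of 0] by simp
    have "L > 0" using w_pos[of 0] wL[of 0] by simp
    have "C \<ge> 0" using B \<open>L > 0\<close> \<open>Y > 0\<close> by (simp add: C_def)
    \<comment> \<open>At this time \<open>2 a s\<close> exceeds the largest possible growth of
      \<open>y + C ln w\<close> by exactly \<open>2 a\<close>.\<close>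
    define s where "s = (\<bar>Y\<bar> + C * ln L - y 0 - C * ln (w 0)) / (2*a) + 1"
    have "ln L \<ge> ln (w 0)" using w_pos[of 0] wL[of 0] by simp
    then have "C * ln L \<ge> C * ln (w 0)" using \<open>C \<ge> 0\<close> by (rule mult_left_mono)
    then have "s \<ge> 0" using y_le[of 0] a by (auto simp: s_def intro!: add_nonneg_nonneg divide_nonneg_pos)
    then have "y 0 + C * ln (w 0) + 2 * a * s \<le> y s + C * ln (w s)" using inc[of s] by simp
    moreover have "C * ln (w s) \<le> C * ln L" using \<open>C \<ge> 0\<close> w_pos[of s] wL[of s] by (intro mult_left_mono) auto
    ultimately have "2 * a * s \<le> Y + C * ln L - y 0 - C * ln (w 0)" using y_le[of s] by linarith
    moreover have "2 * a * s = \<bar>Y\<bar> + C * ln L - y 0 - C * ln (w 0) + 2 * a"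
      using a by (simp add: s_def field_simps)
    ultimately show False using a by linarith
  qed
  then show ?thesis
    unfolding filterlim_at_top eventually_at_top_linorder
    by (meson less_imp_le order_trans w_mono)
qed

section \<open>Successive corrections to the growth of w\<close>

definition "c = 2 * a / B"
definition "\<kappa> = b / B"
definition "D2 = (b * \<kappa> * c - (p - 1) * c\<^sup>2) / B"
text \<open>The limit of \<open>s^2\<close> times the derivative of
  \<open>w - \<kappa> ln w - c s\<close>; the division by \<open>c^2\<close> converts
  \<open>w^2\<close> into \<open>s^2\<close>.\<close>

definition "M2 = (D2 - \<kappa>\<^sup>2 * c) / c\<^sup>2"

lemma c_pos: "c > 0" using a B by (simp add: c_def)

lemma B_c: "B * c = 2 * a" using B by (simp add: c_def)
lemma B_\<kappa>: "B * \<kappa> = b" using B by (simp add: \<kappa>_def)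

lemma isCont_w: "continuous_on S w"
  using Dw by (meson DERIV_isCont continuous_at_imp_continuous_on)

lemma inverse_w: "((\<lambda>s. 1 / w s) \<longlongrightarrow> 0) at_top"
  by (intro tendsto_divide_0[OF tendsto_const] filterlim_at_top_imp_at_infinity w_at_top)

lemma relax:
  assumes "\<And>s. (q has_real_derivative R s - B * w s * q s) (at s)"
    and "((\<lambda>s. R s * (1 / w s)) \<longlongrightarrow> B * l) at_top"
  shows "(q \<longlongrightarrow> l) at_top"
proof (rule tendsto_relaxation[where P = "\<lambda>s. B * w s" and R = R and ?s0.0 = 0])
  show "filterlim (\<lambda>s. B * w s) at_top at_top"
    using B by (intro filterlim_tendsto_pos_mult_at_top[OF tendsto_const _ w_at_top])
  show "((\<lambda>s. R s / (B * w s)) \<longlongrightarrow> l) at_top"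
    using tendsto_divide[OF assms(2) tendsto_const[of B]] B by (simp add: mult.commute)
qed (auto intro!: assms continuous_intros isCont_w)

definition "z s = w s * y s"
definition "z1 s = w s * (z s - c)"
definition "z2 s = w s * (z1 s - \<kappa> * c)"

text \<open>Since \<open>y\<close> is bounded, so is the source term, which is therefore negligible
  against \<open>w\<close>. This is the entry to the chain: divided by \<open>w\<close>, the source
  of \<open>z\<close> is a polynomial in \<open>y\<close>, whose limit is now known.\<close>

lemma y_lim: "(y \<longlongrightarrow> 0) at_top"
proof (rule relax)
  show "(y has_real_derivative (2 * a + b * y s - p * (y s)\<^sup>2) - B * w s * y s) (at s)" for s
    using Dy[of s] by simp
  define C where "C = 2 * a + \<bar>b\<bar> * Y + \<bar>p\<bar> * Y\<^sup>2"
  have bd: "norm (2 * a + b * y s - p * (y s)\<^sup>2) \<le> C" for s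
  proof -
    have y: "0 \<le> y s" "y s \<le> Y" using y_pos[of s] y_le[of s] by auto
    have "\<bar>b * y s\<bar> \<le> \<bar>b\<bar> * Y" using y by (simp add: abs_mult mult_left_mono)
    moreover have "\<bar>p * (y s)\<^sup>2\<bar> \<le> \<bar>p\<bar> * Y\<^sup>2" using y by (simp add: abs_mult mult_left_mono power_mono)
    ultimately show ?thesis using a by (simp add: C_def)
  qed
  show "((\<lambda>s. (2 * a + b * y s - p * (y s)\<^sup>2) * (1 / w s)) \<longlongrightarrow> B * 0) at_top"
    using bd inverse_w
    by (auto intro!: Lim_null_comparison[where g = "\<lambda>s. C * (1 / w s)"] tendsto_mult_right_zero
          simp: abs_mult divide_right_mono w_pos less_imp_le abs_of_pos eventually_at_top_linorder)
qed

lemma Dz: "(z has_real_derivative y s * z s + 2 * a * w s + b * z s - p * y s * z s - B * w s * z s) (at s)"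
  unfolding z_def [abs_def]
  by (rule derivative_eq_intros Dw Dy refl)+ (simp add: algebra_simps power2_eq_square)

lemma z_lim: "(z \<longlongrightarrow> c) at_top"
proof (rule relax)
  show "(z has_real_derivative (y s * z s + 2 * a * w s + b * z s - p * y s * z s) - B * w s * z s) (at s)" for s
    using Dz[of s] by simp
  have "((\<lambda>s. y s * y s + 2 * a + b * y s - p * y s * y s) \<longlongrightarrow> 0 * 0 + 2 * a + b * 0 - p * 0 * 0) at_top"
    by (intro tendsto_intros y_lim)
  then show "((\<lambda>s. (y s * z s + 2 * a * w s + b * z s - p * y s * z s) * (1 / w s)) \<longlongrightarrow> B * c) at_top"
    using B_c w_pos[THEN less_imp_neq, symmetric]
    by (simp add: z_def distrib_left distrib_right add_divide_distrib diff_divide_distrib left_diff_distrib mult.assoc)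
qed

text \<open>Because \<open>B c = 2 a\<close>, the dominant terms \<open>2 a w - B w z\<close> in the
  equation of \<open>z\<close> combine to \<open>- B z1\<close>; multiplication by \<open>w\<close>
  turns them into the damping term of \<open>z1\<close>.\<close>

lemma Dz1: "(z1 has_real_derivative z s * (z s - c) + w s * b * z s - (p - 1) * (z s)\<^sup>2 - B * w s * z1 s) (at s)"
proof -
  have *: "a * 2 = B * c" by (simp add: B_c)
  show ?thesis
  unfolding z1_def [abs_def]
  by (rule derivative_eq_intros Dw Dz refl)+ (simp add: algebra_simps power2_eq_square z_def *)
qed

lemma z1_lim: "(z1 \<longlongrightarrow> \<kappa> * c) at_top"
proof (rule relax)
  show "(z1 has_real_derivative (z s * (z s - c) + w s * b * z s - (p - 1) * (z s)\<^sup>2) - B * w s * z1 s) (at s)" for s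
    by (rule Dz1)
  have "((\<lambda>s. z s * (z s - c) * (1 / w s) + b * z s - (p - 1) * (z s)\<^sup>2 * (1 / w s)) \<longlongrightarrow>
      c * (c - c) * 0 + b * c - (p - 1) * c\<^sup>2 * 0) at_top"
    by (intro tendsto_intros z_lim inverse_w)
  moreover have "z s * (z s - c) * (1 / w s) + b * z s - (p - 1) * (z s)\<^sup>2 * (1 / w s)
    = (z s * (z s - c) + w s * b * z s - (p - 1) * (z s)\<^sup>2) * (1 / w s)" for s
    using w_pos[of s] by (simp add: field_simps)
  ultimately show "((\<lambda>s. (z s * (z s - c) + w s * b * z s - (p - 1) * (z s)\<^sup>2) * (1 / w s)) \<longlongrightarrow> B * (\<kappa> * c)) at_top"
    using B_\<kappa> by (simp add: mult.assoc[symmetric])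
qed

text \<open>The growing source \<open>b w z\<close> of \<open>z1\<close> splits as
  \<open>b z1 + b c w\<close>. Since \<open>B \<kappa> = b\<close>, its second part combines with
  the damping of \<open>z1\<close> to \<open>- B z2\<close>.\<close>

lemma Dz2: "(z2 has_real_derivative z s * (z1 s - \<kappa> * c) + w s * (b * z1 s + z s * (z s - c) - (p - 1) * (z s)\<^sup>2)
    - B * w s * z2 s) (at s)"
proof -
  have "(z2 has_real_derivative w s * y s * (z1 s - \<kappa> * c)
      + (z s * (z s - c) + w s * b * z s - (p - 1) * (z s)\<^sup>2 - B * w s * z1 s - 0) * w s) (at s)"
    unfolding z2_def [abs_def] by (intro DERIV_mult DERIV_diff Dw Dz1 DERIV_const)
  moreover have "w s * y s * (z1 s - \<kappa> * c)
      + (z s * (z s - c) + w s * b * z s - (p - 1) * (z s)\<^sup>2 - B * w s * z1 s - 0) * w s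
    = z s * (z1 s - \<kappa> * c) + w s * (b * z1 s + z s * (z s - c) - (p - 1) * (z s)\<^sup>2) - B * w s * z2 s"
  proof -
    have "W * y * (z1 - \<kappa> * c) + (z * (z - c) + W * b * z - (p - 1) * z\<^sup>2 - B * W * z1 - 0) * W
      = z * (z1 - \<kappa> * c) + W * (b * z1 + z * (z - c) - (p - 1) * z\<^sup>2) - B * W * z2"
      if "B * \<kappa> = b" "z = W * y" "z1 = W * (z - c)" "z2 = W * (z1 - \<kappa> * c)"
      for W y z z1 z2 \<kappa> c :: real
      unfolding that(4) that(3) that(1)[symmetric] that(2) by (simp add: algebra_simps power2_eq_square)
    from this[OF B_\<kappa> z_def z1_def z2_def] show ?thesis .
  qed
  ultimately show ?thesis by simp
qed

lemma z2_lim: "(z2 \<longlongrightarrow> D2) at_top"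
proof (rule relax)
  show "(z2 has_real_derivative (z s * (z1 s - \<kappa> * c) + w s * (b * z1 s + z s * (z s - c) - (p - 1) * (z s)\<^sup>2))
    - B * w s * z2 s) (at s)" for s by (rule Dz2)
  have "((\<lambda>s. z s * (z1 s - \<kappa> * c) * (1 / w s) + (b * z1 s + z s * (z s - c) - (p - 1) * (z s)\<^sup>2)) \<longlongrightarrow>
      c * (\<kappa> * c - \<kappa> * c) * 0 + (b * (\<kappa> * c) + c * (c - c) - (p - 1) * c\<^sup>2)) at_top"
    by (intro tendsto_intros z_lim z1_lim inverse_w)
  moreover have "z s * (z1 s - \<kappa> * c) * (1 / w s) + (b * z1 s + z s * (z s - c) - (p - 1) * (z s)\<^sup>2)
    = (z s * (z1 s - \<kappa> * c) + w s * (b * z1 s + z s * (z s - c) - (p - 1) * (z s)\<^sup>2)) * (1 / w s)" for s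
    using w_pos[of s] by (simp add: field_simps)
  ultimately show "((\<lambda>s. (z s * (z1 s - \<kappa> * c) + w s * (b * z1 s + z s * (z s - c) - (p - 1) * (z s)\<^sup>2)) * (1 / w s)) \<longlongrightarrow> B * D2) at_top"
    using B by (simp add: D2_def mult.assoc)
qed

section \<open>Integration of the corrections\<close>

lemma w_over_s: "((\<lambda>s. w s / s) \<longlongrightarrow> c) at_top"
proof (rule lhospital_at_top_at_top)
  show "((\<lambda>x. z x / 1) \<longlongrightarrow> c) at_top" using z_lim by simp
qed (auto simp: z_def intro!: filterlim_ident always_eventually Dw)

lemma ln_w: "((\<lambda>s. ln (w s) - ln s) \<longlongrightarrow> ln c) at_top"
proof (rule Lim_transform_eventually)
  show "((\<lambda>s. ln (w s / s)) \<longlongrightarrow> ln c) at_top"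
    using c_pos by (intro tendsto_intros w_over_s) auto
  show "\<forall>\<^sub>F s in at_top. ln (w s / s) = ln (w s) - ln s"
    using eventually_gt_at_top[of 0]
  proof eventually_elim
    case (elim s)
    then show ?case using w_pos[of s] by (simp add: ln_div)
  qed
qed

text \<open>Subtracting \<kappa> \<open>ln w\<close> rather than \<kappa> \<open>ln s\<close>
  removes the \<open>1/w\<close> term of \<open>w' - c\<close>: the derivative of the remaining
  function is exactly \<open>(z2 - \<kappa> z1) / w^2\<close>.\<close>

lemma H_lim:
  obtains L where "((\<lambda>s. w s - \<kappa> * ln (w s) - c * s) \<longlongrightarrow> L) at_top"
    "((\<lambda>s. s * (w s - \<kappa> * ln (w s) - c * s - L)) \<longlongrightarrow> - M2) at_top"
proof (rule tendsto_remainder_of_deriv)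
  show "((\<lambda>s. w s - \<kappa> * ln (w s) - c * s) has_real_derivative z s - \<kappa> * y s - c) (at s)" for s
    using w_pos[of s] by (auto intro!: derivative_eq_intros Dw simp: z_def)
  have "((\<lambda>s. (z2 s - \<kappa> * z1 s) / (w s / s)\<^sup>2) \<longlongrightarrow> (D2 - \<kappa> * (\<kappa> * c)) / c\<^sup>2) at_top"
    using c_pos by (intro tendsto_intros z1_lim z2_lim w_over_s) auto
  then have "((\<lambda>s. (z2 s - \<kappa> * z1 s) / (w s / s)\<^sup>2) \<longlongrightarrow> M2) at_top"
    by (simp add: M2_def power2_eq_square mult.assoc)
  then show "((\<lambda>s. s\<^sup>2 * (z s - \<kappa> * y s - c)) \<longlongrightarrow> M2) at_top"
  proof (rule Lim_transform_eventually)
    show "\<forall>\<^sub>F s in at_top. (z2 s - \<kappa> * z1 s) / (w s / s)\<^sup>2 = s\<^sup>2 * (z s - \<kappa> * y s - c)"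
      using eventually_gt_at_top[of 0]
    proof eventually_elim
      case (elim s)
      then show ?case using w_pos[of s]
        by (simp add: z2_def z1_def z_def field_simps power2_eq_square)
    qed
  qed
qed (rule that)

text \<open>It remains to replace \<open>ln w\<close> by \<open>ln s\<close> with an error
  \<open>o(1/s)\<close>. Writing \<open>w = c s (1 + x)\<close> gives
  \<open>ln w = ln c + ln s + ln (1 + x)\<close>, where \<open>s x\<close> is known exactly in terms
  of \<open>ln w\<close> and \<open>H\<close>. The first-order part of \<open>ln (1 + x)\<close>
  produces the term with \<open>ln s / s\<close> and the contribution
  \<open>\<kappa> K / c\<close>.\<close>

lemma expansion:
  obtains K where "((\<lambda>s. w s - c * s - \<kappa> * ln s) \<longlongrightarrow> K) at_top"
    "((\<lambda>s. s * (w s - c * s - \<kappa> * ln s - K - \<kappa>\<^sup>2 / c * (ln s / s))) \<longlongrightarrow> \<kappa> * K / c - M2) at_top"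
proof -
  obtain L where L: "((\<lambda>s. w s - \<kappa> * ln (w s) - c * s) \<longlongrightarrow> L) at_top"
    "((\<lambda>s. s * (w s - \<kappa> * ln (w s) - c * s - L)) \<longlongrightarrow> - M2) at_top" by (rule H_lim)
  define K where "K = L + \<kappa> * ln c"
  define H where "H s = w s - \<kappa> * ln (w s) - c * s" for s
  define x where "x s = w s / (c * s) - 1" for s
  have 1: "((\<lambda>s. w s - c * s - \<kappa> * ln s) \<longlongrightarrow> K) at_top"
    using tendsto_add[OF L(1) tendsto_mult[OF tendsto_const[of \<kappa>] ln_w]]
    by (simp add: K_def algebra_simps)
  have x0: "(x \<longlongrightarrow> 0) at_top"
    using tendsto_diff[OF tendsto_divide[OF w_over_s tendsto_const[of c]] tendsto_const[of 1]] c_pos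
    by (simp add: x_def[abs_def] field_simps)
  have sx: "s * x s = (\<kappa> * ln (w s) + H s) / c" if "s > 0" for s
    using that c_pos by (simp add: x_def H_def field_simps)
  \<comment> \<open>As \<open>s x\<close> grows at most like a logarithm,
    \<open>s x^2 = (s x / sqrt s)^2\<close> tends to 0, which is what the quadratic error of
    \<open>ln (1 + x)\<close> requires.\<close>
  have ln0: "((\<lambda>s::real. ln s / sqrt s) \<longlongrightarrow> 0) at_top"
  proof (rule Lim_transform_eventually)
    show "((\<lambda>s::real. 2 * (ln (sqrt s) / sqrt s)) \<longlongrightarrow> 0) at_top"
      using tendsto_mult[OF tendsto_const[of 2] filterlim_compose[OF ln_x_over_x_tendsto_0 sqrt_at_top]] by simp
    show "\<forall>\<^sub>F s::real in at_top. 2 * (ln (sqrt s) / sqrt s) = ln s / sqrt s"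
      using eventually_gt_at_top[of 0] by eventually_elim (simp add: ln_sqrt)
  qed
  have sx2: "((\<lambda>s. s * (x s)\<^sup>2) \<longlongrightarrow> 0) at_top"
  proof (rule Lim_transform_eventually)
    have rs: "((\<lambda>s::real. 1 / sqrt s) \<longlongrightarrow> 0) at_top"
      by (intro tendsto_divide_0[OF tendsto_const] filterlim_at_top_imp_at_infinity sqrt_at_top)
    have "((\<lambda>s. ((\<kappa> * ((ln (w s) - ln s) * (1 / sqrt s) + ln s / sqrt s) + H s * (1 / sqrt s)) / c)\<^sup>2) \<longlongrightarrow>
        ((\<kappa> * (ln c * 0 + 0) + L * 0) / c)\<^sup>2) at_top"
      using c_pos by (intro tendsto_intros ln_w ln0 rs L(1)[folded H_def]) auto
    then show "((\<lambda>s. ((\<kappa> * ((ln (w s) - ln s) * (1 / sqrt s) + ln s / sqrt s) + H s * (1 / sqrt s)) / c)\<^sup>2) \<longlongrightarrow> 0) at_top"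
      by simp
    show "\<forall>\<^sub>F s in at_top. ((\<kappa> * ((ln (w s) - ln s) * (1 / sqrt s) + ln s / sqrt s) + H s * (1 / sqrt s)) / c)\<^sup>2 = s * (x s)\<^sup>2"
      using eventually_gt_at_top[of 0]
    proof eventually_elim
      case (elim s)
      have "((\<kappa> * ((ln (w s) - ln s) * (1 / sqrt s) + ln s / sqrt s) + H s * (1 / sqrt s)) / c)
          = (s * x s) / sqrt s" using elim by (simp add: sx field_simps)
      also have "\<dots>\<^sup>2 = s * (x s)\<^sup>2" using elim by (simp add: power_divide power_mult_distrib) (simp add: power2_eq_square)
      finally show ?case .
    qed
  qed
  have "((\<lambda>s. s * (ln (1 + x s) - x s)) \<longlongrightarrow> 0) at_top"
  proof (rule Lim_null_comparison)
    show "((\<lambda>s. 2 * (s * (x s)\<^sup>2)) \<longlongrightarrow> 0) at_top" using tendsto_mult[OF tendsto_const[of 2] sx2] by simp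
    have "\<forall>\<^sub>F s in at_top. \<bar>x s\<bar> < 1/2" using tendstoD[OF x0, of "1/2"] by (simp add: dist_real_def)
    then show "\<forall>\<^sub>F s in at_top. norm (s * (ln (1 + x s) - x s)) \<le> 2 * (s * (x s)\<^sup>2)"
      using eventually_gt_at_top[of 0]
    proof eventually_elim
      case (elim s)
      then have "s * \<bar>ln (1 + x s) - x s\<bar> \<le> s * (2 * (x s)\<^sup>2)"
        by (intro mult_left_mono abs_ln_one_plus_x_minus_x_bound) auto
      then show ?case using elim by (simp add: abs_mult)
    qed
  qed
  then have "((\<lambda>s. \<kappa> * (s * (ln (1 + x s) - x s)) + \<kappa> / c * (\<kappa> * (ln (w s) - ln s) + H s)
      + s * (H s - L)) \<longlongrightarrow> \<kappa> * 0 + \<kappa> / c * (\<kappa> * ln c + L) + - M2) at_top"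
    by (intro tendsto_intros ln_w L[folded H_def])
  then have "((\<lambda>s. \<kappa> * (s * (ln (1 + x s) - x s)) + \<kappa> / c * (\<kappa> * (ln (w s) - ln s) + H s)
      + s * (H s - L)) \<longlongrightarrow> \<kappa> * K / c - M2) at_top" by (simp add: K_def add.commute)
  then have 2: "((\<lambda>s. s * (w s - c * s - \<kappa> * ln s - K - \<kappa>\<^sup>2 / c * (ln s / s))) \<longlongrightarrow> \<kappa> * K / c - M2) at_top"
  proof (rule Lim_transform_eventually)
    show "\<forall>\<^sub>F s in at_top. \<kappa> * (s * (ln (1 + x s) - x s)) + \<kappa> / c * (\<kappa> * (ln (w s) - ln s) + H s)
      + s * (H s - L) = s * (w s - c * s - \<kappa> * ln s - K - \<kappa>\<^sup>2 / c * (ln s / s))"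
      using eventually_gt_at_top[of 0]
    proof eventually_elim
      case (elim s)
      have "1 + x s = w s / (c * s)" by (simp add: x_def)
      then have ln: "ln (1 + x s) = ln (w s) - ln c - ln s"
        using w_pos[of s] elim c_pos by (simp add: ln_div ln_mult)
      have "\<kappa> * (s * (ln (1 + x s) - x s)) = \<kappa> * s * ln (1 + x s) - \<kappa> * (s * x s)" by (simp add: algebra_simps)
      also have "\<dots> = \<kappa> * s * (ln (w s) - ln c - ln s) - \<kappa> / c * (\<kappa> * ln (w s) + H s)"
        using elim by (simp add: ln sx)
      finally have "\<kappa> * (s * (ln (1 + x s) - x s)) + \<kappa> / c * (\<kappa> * (ln (w s) - ln s) + H s) + s * (H s - L)
        = \<kappa> * s * (ln (w s) - ln c - ln s) - \<kappa>\<^sup>2 / c * ln s + s * (H s - L)"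
        by (simp add: algebra_simps power2_eq_square)
      also have "\<dots> = s * (w s - c * s - \<kappa> * ln s - K - \<kappa>\<^sup>2 / c * (ln s / s))"
        using elim by (simp add: H_def K_def algebra_simps)
      finally show ?case .
    qed
  qed
  from 1 2 show ?thesis by (rule that)
qed

text \<open>Division by \<open>c\<close> eliminates \<open>B\<close>: the \<kappa>-part of
  \<open>D2\<close> cancels in \<open>M2\<close>, which leaves \<open>M2 = (1 - p) / B\<close> and
  \<open>M2 / c = (1 - p) / (2 a)\<close>, while \<open>\<kappa> / c = b / (2 a)\<close>. Only
  \<open>L\<close> can still depend on \<open>B\<close> and on the particular solution.\<close>

lemma normalized_expansion:
  obtains L where "((\<lambda>s. w s / c - s - b / (2 * a) * ln s) \<longlongrightarrow> L) at_top"
    "((\<lambda>s. s * (w s / c - s - b / (2 * a) * ln s - L - (b / (2 * a))\<^sup>2 * (ln s / s)))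
       \<longlongrightarrow> b / (2 * a) * L - (1 - p) / (2 * a)) at_top"
proof -
  obtain K where K: "((\<lambda>s. w s - c * s - \<kappa> * ln s) \<longlongrightarrow> K) at_top"
    "((\<lambda>s. s * (w s - c * s - \<kappa> * ln s - K - \<kappa>\<^sup>2 / c * (ln s / s))) \<longlongrightarrow> \<kappa> * K / c - M2) at_top"
    by (rule expansion)
  have \<rho>: "b / (2 * a) = \<kappa> / c" using a B by (simp add: \<kappa>_def c_def)
  have "M2 / c = (1 - p) / (B * c)"
  proof -
    have "((b * k * x - (p - 1) * x\<^sup>2) / B - k\<^sup>2 * x) / x\<^sup>2 / x = (1 - p) / (B * x)"
      if "B * k = b" "x > 0" for k x :: real
      unfolding that(1)[symmetric] using that(2) B by (simp add: field_simps power2_eq_square)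
    from this[OF B_\<kappa> c_pos] show ?thesis by (simp only: M2_def D2_def)
  qed
  then have M: "M2 / c = (1 - p) / (2 * a)" by (simp add: B_c)
  show ?thesis
  proof (rule that[of "K / c"])
    show "((\<lambda>s. w s / c - s - b / (2 * a) * ln s) \<longlongrightarrow> K / c) at_top"
      using tendsto_divide[OF K(1) tendsto_const[of c]] c_pos by (simp add: \<rho> diff_divide_distrib)
    have "s * (w s - c * s - \<kappa> * ln s - K - \<kappa>\<^sup>2 / c * (ln s / s)) / c
      = s * (w s / c - s - \<kappa> / c * ln s - K / c - (\<kappa> / c)\<^sup>2 * (ln s / s))" for s
    proof -
      have "(w s - c * s - \<kappa> * ln s - K - \<kappa>\<^sup>2 / c * X) / c
        = w s / c - s - \<kappa> / c * ln s - K / c - (\<kappa> / c)\<^sup>2 * X" for X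
        using c_pos by (simp add: diff_divide_distrib power2_eq_square)
      then show ?thesis by (metis times_divide_eq_right)
    qed
    moreover have "(\<kappa> * K / c - M2) / c = b / (2 * a) * (K / c) - (1 - p) / (2 * a)"
      unfolding M[symmetric] \<rho> by (simp add: diff_divide_distrib)
    ultimately show "((\<lambda>s. s * (w s / c - s - b / (2 * a) * ln s - K / c - (b / (2 * a))\<^sup>2 * (ln s / s)))
       \<longlongrightarrow> b / (2 * a) * (K / c) - (1 - p) / (2 * a)) at_top"
      using tendsto_divide[OF K(2) tendsto_const[of c]] c_pos by (simp add: \<rho>)
  qed
qed

end

section \<open>The equations in terms of the logarithmic derivative\<close>

text \<open>Here \<psi> is \<open>r u' / u\<close>. In this unknown the second-order equation
  becomes first-order, autonomous in \<open>ln r\<close> apart from the factor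
  \<open>u powr (1 - m) * r powr \<theta>\<close>. The exponent \<theta> covers both equations:
  their lower-order terms carry the weight \<open>r powr (\<theta> - 2)\<close>.\<close>

definition fde_system ::
  "nat \<Rightarrow> real \<Rightarrow> real \<Rightarrow> real \<Rightarrow> real \<Rightarrow> (real \<Rightarrow> real) \<Rightarrow> (real \<Rightarrow> real) \<Rightarrow> bool" where
  "fde_system n m \<theta> al be u \<psi> \<longleftrightarrow> (\<forall>r>0. u r > 0 \<and>
     (u has_real_derivative u r * \<psi> r / r) (at r) \<and>
     (\<psi> has_real_derivative
        - (m * (\<psi> r)\<^sup>2 + (real n - 2) * \<psi> r
           + u r powr (1 - m) * r powr \<theta> * (al + be * \<psi> r) / (real n - 1)) / r) (at r))"

lemma fde_op_log_deriv:
  assumes m: "m \<noteq> 0" and r: "r > 0" and u_pos: "\<And>x. x > 0 \<Longrightarrow> u x > 0"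
    and Du: "\<And>x. x > 0 \<Longrightarrow> (u has_real_derivative u x * \<psi> x / x) (at x)"
    and D\<psi>: "(\<psi> has_real_derivative \<psi>') (at r)"
  shows "fde_op n m u r
    = (real n - 1) * u r powr m / r\<^sup>2 * (r * \<psi>' + m * (\<psi> r)\<^sup>2 + (real n - 2) * \<psi> r)"
proof -
  have D1: "((\<lambda>x. u x powr m) has_real_derivative m * u x powr m * \<psi> x / x) (at x)" if "x > 0" for x
  proof -
    have "((\<lambda>x. u x powr m) has_real_derivative m * u x powr (m - 1) * (u x * \<psi> x / x)) (at x)"
      using u_pos[OF that] by (auto intro!: derivative_eq_intros Du that)
    moreover have "u x powr (m - 1) * u x = u x powr m"
      using u_pos[OF that] by (simp add: powr_diff)
    ultimately show ?thesis by (simp add: mult.assoc[symmetric]) (simp add: mult.assoc)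
  qed
  have d1: "deriv (\<lambda>x. u x powr m) x = m * u x powr m * \<psi> x / x" if "x > 0" for x
    using D1[OF that] by (rule DERIV_imp_deriv)
  have "((\<lambda>x. m * V x * \<psi> x / x) has_real_derivative
      m * V r / r\<^sup>2 * (m * (\<psi> r)\<^sup>2 + r * \<psi>' - \<psi> r)) (at r)"
    if "(V has_real_derivative m * V r * \<psi> r / r) (at r)" for V
    using r by (auto intro!: derivative_eq_intros that D\<psi> simp: field_simps power2_eq_square)
  from this[OF D1[OF r]] have "(deriv (\<lambda>x. u x powr m) has_real_derivative
      m * u r powr m / r\<^sup>2 * (m * (\<psi> r)\<^sup>2 + r * \<psi>' - \<psi> r)) (at r)"
    by (rule has_field_derivative_transform_within_open[of _ _ _ "{0<..}"]) (use r d1 in auto)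
  then have "deriv (deriv (\<lambda>x. u x powr m)) r = m * u r powr m / r\<^sup>2 * (m * (\<psi> r)\<^sup>2 + r * \<psi>' - \<psi> r)"
    by (rule DERIV_imp_deriv)
  then have "fde_op n m u r = (real n - 1) / m * (m * u r powr m / r\<^sup>2 * (m * (\<psi> r)\<^sup>2 + r * \<psi>' - \<psi> r)
      + (real n - 1) / r * (m * u r powr m * \<psi> r / r))"
    by (simp only: fde_op_def d1[OF r])
  also have "\<dots> = (real n - 1) * u r powr m / r\<^sup>2 * (r * \<psi>' + m * (\<psi> r)\<^sup>2 + (real n - 2) * \<psi> r)"
    using r m by (simp add: field_simps power2_eq_square)
  finally show ?thesis .
qed

lemma C2_posI:
  assumes Du: "\<And>x. x > 0 \<Longrightarrow> (u has_real_derivative u x * \<psi> x / x) (at x)"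
    and D\<psi>: "\<And>x. x > 0 \<Longrightarrow> (\<psi> has_real_derivative \<psi>' x) (at x)"
    and cont: "continuous_on {0<..} \<psi>'"
  shows "C2_pos u"
proof -
  have d1: "deriv u x = u x * \<psi> x / x" if "x > 0" for x using Du[OF that] by (rule DERIV_imp_deriv)
  have D2: "(deriv u has_real_derivative (u r * \<psi> r / r * \<psi> r + u r * \<psi>' r) / r - u r * \<psi> r / r\<^sup>2) (at r)"
    if r: "r > 0" for r
  proof -
    have "((\<lambda>x. u x * \<psi> x / x) has_real_derivative
        (u r * \<psi> r / r * \<psi> r + u r * \<psi>' r) / r - u r * \<psi> r / r\<^sup>2) (at r)"
      using r by (auto intro!: derivative_eq_intros Du D\<psi> simp: field_simps power2_eq_square)
    then show ?thesis
      by (rule has_field_derivative_transform_within_open[of _ _ _ "{0<..}"]) (use r d1 in auto)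
  qed
  have cu: "continuous_on {0<..} u" "continuous_on {0<..} \<psi>"
    using Du D\<psi> by (auto intro!: continuous_at_imp_continuous_on simp: DERIV_isCont) (meson DERIV_isCont)+
  have "continuous_on {0<..} (\<lambda>r. (u r * \<psi> r / r * \<psi> r + u r * \<psi>' r) / r - u r * \<psi> r / r\<^sup>2)"
    by (intro continuous_intros cu cont) auto
  then have "continuous_on {0<..} (deriv (deriv u))"
    by (rule continuous_on_eq) (use D2 in \<open>auto intro!: DERIV_imp_deriv[symmetric]\<close>)
  then show ?thesis
    using Du D2 by (auto simp: C2_pos_def real_differentiable_def intro: exI)
qed

text \<open>The passage is reversible: positivity permits division by \<open>u\<close>, and the
  right-hand sides of the system are continuous, which gives back the continuous second derivative
  demanded by \<open>C2_pos\<close>.\<close>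

lemma fde_system_iff:
  assumes n: "n \<ge> 2" and m: "m \<noteq> 0"
  shows "(\<exists>\<psi>. fde_system n m \<theta> al be u \<psi>) \<longleftrightarrow>
    C2_pos u \<and> (\<forall>r>0. u r > 0) \<and>
    (\<forall>r>0. fde_op n m u r + r powr (\<theta> - 2) * (al * u r + be * r * deriv u r) = 0)"
proof -
  have n1: "real n - 1 > 0" using n by linarith
  have eq: "(real n - 1) * U powr m / r\<^sup>2 * (r * p' + m * p\<^sup>2 + (real n - 2) * p)
        + r powr (\<theta> - 2) * (al * U + be * r * (U * p / r)) = 0
      \<longleftrightarrow> p' = - (m * p\<^sup>2 + (real n - 2) * p + U powr (1 - m) * r powr \<theta> * (al + be * p) / (real n - 1)) / r"
    if "r > 0" "U > 0" for r U p p' :: real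
  proof -
    have U: "U powr (1 - m) = U / U powr m" using that by (simp add: powr_diff)
    have R: "r powr (\<theta> - 2) = r powr \<theta> / r\<^sup>2" using that by (simp add: powr_diff)
    have pos: "U powr m > 0" "r powr \<theta> > 0" using that by auto
    define N where "N = real n - 1"
    have "(N * U powr m / r\<^sup>2 * (r * p' + m * p\<^sup>2 + (real n - 2) * p)
        + r powr \<theta> / r\<^sup>2 * (al * U + be * r * (U * p / r)) = 0)
      \<longleftrightarrow> N * U powr m * (r * p' + m * p\<^sup>2 + (real n - 2) * p) + r powr \<theta> * U * (al + be * p) = 0"
    proof -
      have "N * U powr m / r\<^sup>2 * (r * p' + m * p\<^sup>2 + (real n - 2) * p)
          + r powr \<theta> / r\<^sup>2 * (al * U + be * r * (U * p / r))
        = (N * U powr m * (r * p' + m * p\<^sup>2 + (real n - 2) * p) + r powr \<theta> * U * (al + be * p)) / r\<^sup>2"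
        using that by (simp add: add_divide_distrib distrib_left distrib_right mult_ac)
      then show ?thesis using that by simp
    qed
    also have "\<dots> \<longleftrightarrow> r * p' = - (m * p\<^sup>2 + (real n - 2) * p + U / U powr m * r powr \<theta> * (al + be * p) / N)"
      using n1 pos by (simp add: N_def[symmetric] field_simps)
    also have "\<dots> \<longleftrightarrow> p' = - (m * p\<^sup>2 + (real n - 2) * p + U / U powr m * r powr \<theta> * (al + be * p) / N) / r"
      using that by (auto simp: eq_divide_eq mult.commute)
    finally show ?thesis by (simp add: U R N_def)
  qed
  show ?thesis (is "?L \<longleftrightarrow> ?R")
  proof
    assume ?L
    then obtain \<psi> where sys: "fde_system n m \<theta> al be u \<psi>" ..
    define \<psi>' where "\<psi>' r = - (m * (\<psi> r)\<^sup>2 + (real n - 2) * \<psi> r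
           + u r powr (1 - m) * r powr \<theta> * (al + be * \<psi> r) / (real n - 1)) / r" for r
    have *: "u r > 0" "(u has_real_derivative u r * \<psi> r / r) (at r)"
      "(\<psi> has_real_derivative \<psi>' r) (at r)" if "r > 0" for r
      using sys that by (auto simp: fde_system_def \<psi>'_def)
    have cu: "continuous_on {0<..} u" "continuous_on {0<..} \<psi>"
      by (auto intro!: continuous_at_imp_continuous_on DERIV_isCont[OF *(2)] DERIV_isCont[OF *(3)])
    have "continuous_on {0<..} \<psi>'"
      unfolding \<psi>'_def[abs_def] using n1 *(1)
      by (intro continuous_intros cu) (auto simp: less_imp_neq[symmetric])
    then have "C2_pos u" using * by (intro C2_posI)
    moreover have "fde_op n m u r + r powr (\<theta> - 2) * (al * u r + be * r * deriv u r) = 0" if "r > 0" for r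
      using fde_op_log_deriv[of m r u \<psi> "\<psi>' r" n] eq[OF that *(1)[OF that], of "\<psi>' r" "\<psi> r"] *[OF that] * m that
      by (auto simp: DERIV_imp_deriv[OF *(2)] \<psi>'_def)
    ultimately show ?R using * by blast
  next
    assume R: ?R
    define \<psi> where "\<psi> r = r * deriv u r / u r" for r
    have du: "(u has_real_derivative deriv u r) (at r)" "(deriv u has_real_derivative deriv (deriv u) r) (at r)"
      if "r > 0" for r
      using R that unfolding C2_pos_def by (auto simp: DERIV_deriv_iff_real_differentiable)
    have Du: "(u has_real_derivative u r * \<psi> r / r) (at r)" if "r > 0" for r
      using du(1)[OF that] R that by (simp add: \<psi>_def less_imp_neq[symmetric])
    have "\<exists>\<psi>'. (\<psi> has_real_derivative \<psi>') (at r)" if "r > 0" for r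
      unfolding \<psi>_def[abs_def] using R that
      by (intro exI) (rule derivative_eq_intros du refl | force)+
    then obtain \<psi>' where D\<psi>: "(\<psi> has_real_derivative \<psi>' r) (at r)" if "r > 0" for r by metis
    have "\<psi>' r = - (m * (\<psi> r)\<^sup>2 + (real n - 2) * \<psi> r
           + u r powr (1 - m) * r powr \<theta> * (al + be * \<psi> r) / (real n - 1)) / r" if "r > 0" for r
    proof (rule eq[THEN iffD1])
      have "fde_op n m u r + r powr (\<theta> - 2) * (al * u r + be * r * deriv u r) = 0" using R that by blast
      then show "(real n - 1) * u r powr m / r\<^sup>2 * (r * \<psi>' r + m * (\<psi> r)\<^sup>2 + (real n - 2) * \<psi> r)
        + r powr (\<theta> - 2) * (al * u r + be * r * (u r * \<psi> r / r)) = 0"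
        using fde_op_log_deriv[of m r u \<psi> "\<psi>' r" n] R that m Du D\<psi> by (simp add: DERIV_imp_deriv[OF Du])
    qed (use R that in auto)
    then show ?L using R Du D\<psi> by (auto simp: fde_system_def intro!: exI[of _ \<psi>])
  qed
qed

lemma is_f_iff:
  assumes "n \<ge> 2" "m \<noteq> 0"
  shows "is_f n m \<beta> A f \<longleftrightarrow> (\<exists>\<psi>. fde_system n m 2 (2 * \<beta> / (1 - m)) \<beta> f \<psi>) \<and>
    ((\<lambda>r. r powr ((real n - 2) / m) * f r) \<longlongrightarrow> A) at_top"
  unfolding fde_system_iff[OF assms] by (auto simp: is_f_def Let_def add.assoc)

section \<open>Rescaling and inversion\<close>

lemma fde_system_scale:
  assumes sys: "fde_system n m 2 al be u \<psi>" and ab: "a > 0" "b > 0" and m: "m < 1"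
  shows "fde_system n m 2 (al * (b\<^sup>2 * a powr (m - 1))) (be * (b\<^sup>2 * a powr (m - 1)))
    (\<lambda>r. a * u (b * r)) (\<lambda>r. \<psi> (b * r))"
  unfolding fde_system_def
proof (intro allI impI conjI)
  fix r :: real assume r: "r > 0"
  then have br: "b * r > 0" using ab by simp
  have *: "u (b * r) > 0" "(u has_real_derivative u (b * r) * \<psi> (b * r) / (b * r)) (at (b * r))"
    "(\<psi> has_real_derivative
        - (m * (\<psi> (b * r))\<^sup>2 + (real n - 2) * \<psi> (b * r)
           + u (b * r) powr (1 - m) * (b * r) powr 2 * (al + be * \<psi> (b * r)) / (real n - 1)) / (b * r)) (at (b * r))"
    using sys br by (auto simp: fde_system_def)
  show "a * u (b * r) > 0" using * ab by simp
  show "((\<lambda>r. a * u (b * r)) has_real_derivative a * u (b * r) * \<psi> (b * r) / r) (at r)"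
    using ab r by (auto intro!: derivative_eq_intros DERIV_chain2[where f = u and g = "\<lambda>r. b * r", OF *(2)])
  have "(a * u (b * r)) powr (1 - m) = a powr (1 - m) * u (b * r) powr (1 - m)"
    using ab *(1) by (simp add: powr_mult)
  moreover have "a powr (1 - m) * a powr (m - 1) = 1"
    using ab by (simp add: powr_add[symmetric])
  moreover have "(b * r) powr 2 = b\<^sup>2 * r powr 2" using ab r by (simp add: powr_mult)
  \<comment> \<open>Rescaling multiplies \<open>u powr (1 - m)\<close> by
    \<open>a powr (1 - m)\<close>, and \<open>r powr 2\<close> falls short of
    \<open>(b * r) powr 2\<close> by \<open>b^2\<close>; the common factor of the new coefficients
    compensates both.\<close>
  ultimately have e: "(a * u (b * r)) powr (1 - m) * r powr 2 *
      (al * (b\<^sup>2 * a powr (m - 1)) + be * (b\<^sup>2 * a powr (m - 1)) * \<psi> (b * r))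
    = u (b * r) powr (1 - m) * (b * r) powr 2 * (al + be * \<psi> (b * r))"
    by algebra
  show "((\<lambda>r. \<psi> (b * r)) has_real_derivative
         - (m * (\<psi> (b * r))\<^sup>2 + (real n - 2) * \<psi> (b * r) +
            (a * u (b * r)) powr (1 - m) * r powr 2 *
            (al * (b\<^sup>2 * a powr (m - 1)) + be * (b\<^sup>2 * a powr (m - 1)) * \<psi> (b * r)) / (real n - 1)) / r) (at r)"
    unfolding e
    by (rule DERIV_cong[OF DERIV_chain2[where f = \<psi> and g = "\<lambda>r. b * r", OF *(3) DERIV_cmult_Id]])
       (use ab r in simp)
qed

text \<open>Both coefficients acquire the same factor, so the relation \<alpha> = 2 \<beta> / (1 -
  m) survives. The two free parameters allow \<beta>, up to its sign, and \<open>A\<close> to be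
  normalised separately.\<close>

lemma is_f_scale:
  assumes n: "n \<ge> 2" and m: "0 < m" "m < 1" and f: "is_f n m \<beta> A f" and ab: "a > 0" "b > 0"
  shows "is_f n m (\<beta> * (b\<^sup>2 * a powr (m - 1))) (a * b powr (- ((real n - 2) / m)) * A) (\<lambda>r. a * f (b * r))"
proof -
  have m0: "m \<noteq> 0" using m by simp
  obtain \<psi> where \<psi>: "fde_system n m 2 (2 * \<beta> / (1 - m)) \<beta> f \<psi>"
    and lim: "((\<lambda>r. r powr ((real n - 2) / m) * f r) \<longlongrightarrow> A) at_top"
    using f is_f_iff[OF n m0] by auto
  have "filterlim (\<lambda>r. b * r) at_top at_top"
    using ab by (intro filterlim_tendsto_pos_mult_at_top[OF tendsto_const] filterlim_ident)
  from tendsto_mult[OF tendsto_const filterlim_compose[OF lim this], of "a * b powr (- ((real n - 2) / m))"]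
  have "((\<lambda>r. r powr ((real n - 2) / m) * (a * f (b * r))) \<longlongrightarrow> a * b powr (- ((real n - 2) / m)) * A) at_top"
  proof (rule Lim_transform_eventually)
    show "\<forall>\<^sub>F r in at_top. a * b powr (- ((real n - 2) / m)) * ((b * r) powr ((real n - 2) / m) * f (b * r))
       = r powr ((real n - 2) / m) * (a * f (b * r))"
      using eventually_gt_at_top[of 0]
      by eventually_elim (use ab in \<open>simp add: powr_mult powr_minus field_simps\<close>)
  qed
  moreover have "fde_system n m 2 (2 * (\<beta> * (b\<^sup>2 * a powr (m - 1))) / (1 - m)) (\<beta> * (b\<^sup>2 * a powr (m - 1)))
    (\<lambda>r. a * f (b * r)) (\<lambda>r. \<psi> (b * r))"
    using fde_system_scale[OF \<psi> ab m(2)] by (simp add: mult.assoc)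
  ultimately show ?thesis using is_f_iff[OF n m0] by blast
qed

text \<open>The values at 0 and to its left are those prescribed for \<open>g_sol\<close>; the
  equation concerns only positive \<open>r\<close>.\<close>

definition inversion :: "nat \<Rightarrow> real \<Rightarrow> real \<Rightarrow> (real \<Rightarrow> real) \<Rightarrow> real \<Rightarrow> real" where
  "inversion n m A f r =
     (if r < 0 then 0 else if r = 0 then A else r powr (- ((real n - 2) / m)) * f (1 / r))"

text \<open>The polynomial \<open>m p^2 + (n - 2) p\<close> has the roots 0 and
  \<open>- (n - 2) / m\<close>, hence it is invariant under the reflection that sends
  \<open>p\<close> to \<open>- (n - 2) / m - p\<close>. The exponent \<theta> is such that
  \<open>u powr (1 - m) * r powr \<theta>\<close> takes the same value for both functions at
  reciprocal points.\<close>

lemma fde_system_inversion: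
  assumes sys: "fde_system n m 2 (2 * \<beta> / (1 - m)) \<beta> f \<psi>" and m: "0 < m" "m < 1"
  shows "fde_system n m ((real n - 2) / m - real n) (alpha_t n m (- \<beta>)) (- \<beta>)
    (inversion n m A f) (\<lambda>r. - ((real n - 2) / m) - \<psi> (1 / r))"
  unfolding fde_system_def
proof (intro allI impI conjI)
  fix r :: real assume r: "r > 0"
  define \<sigma> where "\<sigma> = (real n - 2) / m"
  define F where "F = f (1 / r)"
  define p where "p = \<psi> (1 / r)"
  have *: "F > 0" "(f has_real_derivative F * p / (1 / r)) (at (1 / r))"
    "(\<psi> has_real_derivative
        - (m * p\<^sup>2 + (real n - 2) * p
           + F powr (1 - m) * (1 / r) powr 2 * (2 * \<beta> / (1 - m) + \<beta> * p) / (real n - 1)) / (1 / r)) (at (1 / r))"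
    using sys[unfolded fde_system_def, rule_format, OF divide_pos_pos[OF zero_less_one r]]
    unfolding F_def p_def by blast+
  have inv: "inversion n m A f r = r powr (- \<sigma>) * F" using r by (simp add: inversion_def F_def \<sigma>_def)
  show "inversion n m A f r > 0" using r * inv by simp
  have "((\<lambda>r. r powr (- \<sigma>) * f (1 / r)) has_real_derivative
      - \<sigma> * r powr (- \<sigma> - 1) * F + r powr (- \<sigma>) * (F * p / (1 / r) * (- 1 / r\<^sup>2))) (at r)"
    using r by (auto intro!: derivative_eq_intros DERIV_chain2[where f = f and g = "\<lambda>r. 1 / r", OF *(2)] simp: F_def power2_eq_square)
  moreover have "- \<sigma> * r powr (- \<sigma> - 1) * F + r powr (- \<sigma>) * (F * p / (1 / r) * (- 1 / r\<^sup>2))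
      = r powr (- \<sigma>) * F * (- \<sigma> - p) / r"
    using r by (simp add: powr_diff field_simps power2_eq_square)
  ultimately have "((\<lambda>r. r powr (- \<sigma>) * f (1 / r)) has_real_derivative r powr (- \<sigma>) * F * (- \<sigma> - p) / r) (at r)"
    by simp
  then have "(inversion n m A f has_real_derivative r powr (- \<sigma>) * F * (- \<sigma> - p) / r) (at r)"
    by (rule has_field_derivative_transform_within_open[of _ _ _ "{0<..}"])
       (use r in \<open>auto simp: inversion_def \<sigma>_def\<close>)
  then show "(inversion n m A f has_real_derivative
      inversion n m A f r * (- ((real n - 2) / m) - \<psi> (1 / r)) / r) (at r)"
    by (simp add: inv \<sigma>_def p_def)
  have D: "((\<lambda>r. - \<sigma> - \<psi> (1 / r)) has_real_derivative
      - (m * p\<^sup>2 + (real n - 2) * p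
           + F powr (1 - m) * (1 / r) powr 2 * (2 * \<beta> / (1 - m) + \<beta> * p) / (real n - 1)) / r) (at r)"
    using r by (auto intro!: derivative_eq_intros DERIV_chain2[where f = \<psi> and g = "\<lambda>r. 1 / r", OF *(3)] simp: power2_eq_square)
  have ms: "m * \<sigma> = real n - 2" using m by (simp add: \<sigma>_def)
  have "(r powr (- \<sigma>) * F) powr (1 - m) * r powr (\<sigma> - real n)
      = F powr (1 - m) * r powr (- \<sigma> * (1 - m) + (\<sigma> - real n))"
    using r *(1) by (simp add: powr_mult powr_powr powr_add[symmetric])
  also have "- \<sigma> * (1 - m) + (\<sigma> - real n) = - 2" using ms by (simp add: algebra_simps)
  also have "r powr - 2 = (1 / r) powr 2" using r by (simp add: powr_minus_divide powr_divide)
  finally have e1: "inversion n m A f r powr (1 - m) * r powr (\<sigma> - real n) = F powr (1 - m) * (1 / r) powr 2"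
    by (simp add: inv)
  have e2: "alpha_t n m (- \<beta>) + - \<beta> * (- \<sigma> - p) = 2 * \<beta> / (1 - m) + \<beta> * p"
    by (simp add: alpha_t_def \<sigma>_def[symmetric] algebra_simps)
  have e3: "m * (- \<sigma> - p)\<^sup>2 + (real n - 2) * (- \<sigma> - p) = m * p\<^sup>2 + (real n - 2) * p"
    unfolding ms[symmetric] by (simp add: algebra_simps power2_eq_square)
  show "((\<lambda>r. - ((real n - 2) / m) - \<psi> (1 / r)) has_real_derivative
     - (m * (- ((real n - 2) / m) - \<psi> (1 / r))\<^sup>2 + (real n - 2) * (- ((real n - 2) / m) - \<psi> (1 / r)) +
        inversion n m A f r powr (1 - m) * r powr ((real n - 2) / m - real n) *
        (alpha_t n m (- \<beta>) + - \<beta> * (- ((real n - 2) / m) - \<psi> (1 / r))) / (real n - 1)) / r) (at r)"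
    using D unfolding \<sigma>_def[symmetric] p_def[symmetric] e1 e2 e3 .
qed

lemma inversion_tendsto:
  assumes "((\<lambda>r. r powr ((real n - 2) / m) * f r) \<longlongrightarrow> A) at_top"
  shows "(inversion n m A f \<longlongrightarrow> A) (at_right 0)"
proof -
  have "filterlim (\<lambda>r::real. 1 / r) at_top (at_right 0)"
    using filterlim_inverse_at_top_right by (simp add: inverse_eq_divide)
  from filterlim_compose[OF assms this] show ?thesis
  proof (rule Lim_transform_eventually)
    show "\<forall>\<^sub>F r in at_right 0. (1 / r) powr ((real n - 2) / m) * f (1 / r) = inversion n m A f r"
      using eventually_at_right_less[of 0]
      by eventually_elim (simp add: inversion_def powr_divide powr_minus_divide)
  qed
qed

section \<open>Regularity and uniqueness of the inverted profile\<close>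

lemma DERIV_powr_const:
  fixes e r :: real
  assumes "r > 0"
  shows "((\<lambda>r. r powr e) has_real_derivative e * (r powr e / r)) (at r)"
  using assms by (auto intro!: derivative_eq_intros simp: powr_diff)

lemma powr_lim: "e > 0 \<Longrightarrow> ((\<lambda>r::real. r powr e) \<longlongrightarrow> 0) (at_right 0)"
  by (rule tendsto_eq_intros tendsto_powr' tendsto_ident_at refl | force simp: eventually_at_right_field)+

text \<open>Serves to exclude a nonzero flux at 0: such a flux forces a derivative of order
  \<open>1/r^2\<close>, whose integral diverges at the origin.\<close>

lemma deriv_inverse_square_unbounded:
  fixes U U' :: "real \<Rightarrow> real"
  assumes "\<epsilon> > 0" "r0 > 0"
    and U: "\<And>r. 0 < r \<Longrightarrow> r \<le> r0 \<Longrightarrow> (U has_real_derivative U' r) (at r) \<and> U' r \<ge> \<epsilon> / r\<^sup>2"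
  obtains r where "0 < r" "r \<le> r0" "U r < L"
proof -
  define M where "M = U r0 + \<epsilon> / r0"
  define r where "r = min r0 (\<epsilon> / (\<bar>M - L\<bar> + 1))"
  have r: "0 < r" "r \<le> r0" using assms(1,2) by (auto simp: r_def)
  have "U r + \<epsilon> / r \<le> U r0 + \<epsilon> / r0"
  proof (rule DERIV_nonneg_imp_nondecreasing[OF r(2)])
    fix x assume "r \<le> x" "x \<le> r0"
    then have "x > 0" using r by simp
    then have "((\<lambda>r. U r + \<epsilon> / r) has_real_derivative U' x - \<epsilon> / x\<^sup>2) (at x)"
      using U[of x] \<open>x \<le> r0\<close> by (auto intro!: derivative_eq_intros simp: power2_eq_square)
    then show "\<exists>y. ((\<lambda>r. U r + \<epsilon> / r) has_real_derivative y) (at x) \<and> y \<ge> 0"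
      using U[of x] \<open>x \<le> r0\<close> \<open>x > 0\<close> by (intro exI conjI) auto
  qed
  moreover have "\<epsilon> / r \<ge> \<bar>M - L\<bar> + 1"
  proof -
    have "r \<le> \<epsilon> / (\<bar>M - L\<bar> + 1)" by (simp add: r_def)
    then have "r * (\<bar>M - L\<bar> + 1) \<le> \<epsilon>" by (simp add: pos_le_divide_eq)
    then show ?thesis using r by (simp add: pos_le_divide_eq mult.commute)
  qed
  ultimately have "U r < L" unfolding M_def[symmetric] by linarith
  with r show ?thesis by (rule that)
qed

text \<open>First-zero argument: at the smallest point where \<open>f\<close> is not negative,
  \<open>f\<close> vanishes with negative derivative, so it is already positive just to the left.
  Negativity near 0 confines the search to a compact set.\<close>

lemma neg_if_deriv_neg_at_zeros:
  fixes f f' :: "real \<Rightarrow> real"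
  assumes f: "\<And>r. r > 0 \<Longrightarrow> (f has_real_derivative f' r) (at r)"
    and zero: "\<And>r. r > 0 \<Longrightarrow> f r = 0 \<Longrightarrow> f' r < 0"
    and near: "eventually (\<lambda>r. f r < 0) (at_right 0)" and "r > 0"
  shows "f r < 0"
proof (rule ccontr)
  assume "\<not> f r < 0"
  obtain r0 where r0: "r0 > 0" "\<And>x. 0 < x \<Longrightarrow> x < r0 \<Longrightarrow> f x < 0"
    using near by (auto simp: eventually_at_right_field)
  define S where "S = {x \<in> {min r0 r..r}. f x \<ge> 0}"
  have cont: "continuous_on {min r0 r..r} f"
    using r0(1) \<open>r > 0\<close> by (intro continuous_at_imp_continuous_on ballI DERIV_isCont[OF f]) auto
  have "closed S"
    unfolding S_def using continuous_on_closed_Collect_le[OF continuous_on_const[of _ 0] cont] by simp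
  moreover have "bounded S" unfolding S_def by (rule bounded_subset[OF bounded_closed_interval]) auto
  ultimately have "compact S" by (simp add: compact_eq_bounded_closed)
  moreover have "r \<in> S" using \<open>\<not> f r < 0\<close> by (simp add: S_def)
  ultimately obtain x where x: "x \<in> S" "\<And>y. y \<in> S \<Longrightarrow> x \<le> y"
    using compact_attains_inf[of S] by auto
  have "x > 0" "x \<le> r" "f x \<ge> 0" using x(1) r0(1) \<open>r > 0\<close> by (auto simp: S_def)
  have left: "f y < 0" if "0 < y" "y < x" for y
    using x(2)[of y] r0(2)[of y] that \<open>x \<le> r\<close> by (force simp: S_def not_less)
  have "(f \<longlongrightarrow> f x) (at_left x)"
    using DERIV_isCont[OF f[OF \<open>x > 0\<close>]] by (simp add: isCont_def filterlim_at_split)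
  moreover have "eventually (\<lambda>y. y > 0 \<and> y < x) (at_left x)"
    using \<open>x > 0\<close> by (auto simp: eventually_at_left_field)
  then have "eventually (\<lambda>y. f y \<le> 0) (at_left x)"
    by eventually_elim (use left in force)
  ultimately have "f x \<le> 0"
    by (intro tendsto_upperbound) auto
  then have "f x = 0" using \<open>f x \<ge> 0\<close> by simp
  obtain d where d: "d > 0" "\<And>h. 0 < h \<Longrightarrow> h < d \<Longrightarrow> f x < f (x - h)"
    using DERIV_neg_dec_left[OF f[OF \<open>x > 0\<close>] zero[OF \<open>x > 0\<close> \<open>f x = 0\<close>]] by auto
  define h where "h = min d x / 2"
  have "0 < h" "h < d" "h < x" using d(1) \<open>x > 0\<close> by (auto simp: h_def)
  then show False using d(2)[of h] left[of "x - h"] \<open>f x = 0\<close> by simp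
qed

lemma abs_le_if_deriv_le:
  fixes F G F' G' :: "real \<Rightarrow> real"
  assumes F: "\<And>r. 0 < r \<Longrightarrow> r \<le> R \<Longrightarrow> (F has_real_derivative F' r) (at r)"
    and G: "\<And>r. 0 < r \<Longrightarrow> r \<le> R \<Longrightarrow> (G has_real_derivative G' r) (at r)"
    and le: "\<And>r. 0 < r \<Longrightarrow> r \<le> R \<Longrightarrow> \<bar>F' r\<bar> \<le> G' r"
    and lim: "(F \<longlongrightarrow> 0) (at_right 0)" "(G \<longlongrightarrow> 0) (at_right 0)" and r: "0 < r" "r \<le> R"
  shows "\<bar>F r\<bar> \<le> G r"
proof -
  have *: "0 \<le> G r + H r"
    if H: "\<And>r. 0 < r \<Longrightarrow> r \<le> R \<Longrightarrow> (H has_real_derivative H' r) (at r)"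
      "\<And>r. 0 < r \<Longrightarrow> r \<le> R \<Longrightarrow> \<bar>H' r\<bar> \<le> G' r" and HL: "(H \<longlongrightarrow> 0) (at_right 0)"
    for H H' :: "real \<Rightarrow> real"
  proof (rule tendsto_upperbound)
    show "((\<lambda>x. G x + H x) \<longlongrightarrow> 0) (at_right 0)" using tendsto_add[OF lim(2) HL] by simp
    have "G x + H x \<le> G r + H r" if "0 < x" "x < r" for x
    proof (rule DERIV_nonneg_imp_nondecreasing[where f = "\<lambda>x. G x + H x"])
      fix t assume "x \<le> t" "t \<le> r"
      then have t: "0 < t" "t \<le> R" using that r by auto
      then show "\<exists>y. ((\<lambda>x. G x + H x) has_real_derivative y) (at t) \<and> 0 \<le> y"
        using H(2)[OF t] by (intro exI[of _ "G' t + H' t"]) (auto intro!: DERIV_add G H)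
    qed (use that in simp)
    then show "\<forall>\<^sub>F x in at_right 0. G x + H x \<le> G r + H r"
      using r by (auto simp: eventually_at_right_field)
  qed simp
  have "0 \<le> G r + F r" by (rule *[OF F le lim(1)])
  moreover have "0 \<le> G r + - F r"
  proof (rule *[where H = "\<lambda>x. - F x" and H' = "\<lambda>x. - F' x"])
    show "((\<lambda>x. - F x) has_real_derivative - F' x) (at x)" if "0 < x" "x \<le> R" for x
      using F[OF that] by (rule DERIV_minus)
    show "\<bar>- F' x\<bar> \<le> G' x" if "0 < x" "x \<le> R" for x using le[OF that] by simp
    show "((\<lambda>x. - F x) \<longlongrightarrow> 0) (at_right 0)" using tendsto_minus[OF lim(1)] by simp
  qed
  ultimately show ?thesis by simp
qed

text \<open>The numbers \<open>y / x\<close> and \<open>(x - y) / x\<close> sum to 1 and lie in the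
  unit interval, where \<open>t \<le> t powr q\<close>.\<close>

lemma powr_diff_le:
  fixes x y q :: real
  assumes "0 < q" "q \<le> 1" "0 \<le> y" "y \<le> x"
  shows "x powr q - y powr q \<le> (x - y) powr q"
proof (cases "x = 0")
  case False
  then have x: "x > 0" using assms by simp
  have 1: "t \<le> t powr q" if "0 \<le> t" "t \<le> 1" for t :: real
    using powr_mono'[of q 1 t] that assms by (cases "t = 0") auto
  have "x powr q = x powr q * (y / x + (x - y) / x)" using x by (simp add: field_simps)
  also have "\<dots> \<le> x powr q * ((y / x) powr q + ((x - y) / x) powr q)"
    using x assms by (intro mult_left_mono add_mono 1) (auto simp: field_simps)
  also have "\<dots> = y powr q + (x - y) powr q"
    using x assms by (simp add: powr_divide distrib_left)
  finally show ?thesis by simp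
qed (use assms in simp)

text \<open>Uniqueness is proved for \<open>g powr m\<close>, while the source terms contain
  \<open>g\<close> itself; this leads back from the former to the latter. For \<open>m < 1\<close>
  the slope of the power is least at the upper end \<open>M\<close>.\<close>

lemma abs_diff_le_powr_diff:
  fixes x y m M :: real
  assumes "0 < m" "m < 1" "0 < x" "x \<le> M" "0 < y" "y \<le> M"
  shows "\<bar>x - y\<bar> \<le> M powr (1 - m) / m * \<bar>x powr m - y powr m\<bar>"
proof -
  have *: "b - a \<le> M powr (1 - m) / m * (b powr m - a powr m)" if ab: "0 < a" "a < b" "b \<le> M" for a b
  proof -
    have "\<exists>z. z > a \<and> z < b \<and> b powr m - a powr m = (b - a) * (m * z powr (m - 1))"
      using ab by (intro MVT2) (auto intro!: derivative_eq_intros)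
    then obtain z where z: "a < z" "z < b" "b powr m - a powr m = (b - a) * (m * z powr (m - 1))" by blast
    have "M powr (m - 1) \<le> z powr (m - 1)"
      using z ab assms by (intro powr_mono2') auto
    then have "M powr (1 - m) * M powr (m - 1) \<le> M powr (1 - m) * z powr (m - 1)"
      by (rule mult_left_mono) simp
    then have "1 \<le> M powr (1 - m) * z powr (m - 1)"
      using ab by (simp add: powr_add[symmetric])
    then have "(b - a) * 1 \<le> (b - a) * (M powr (1 - m) * z powr (m - 1))"
      using ab by (intro mult_left_mono) auto
    then show ?thesis using assms by (simp add: z(3) mult_ac)
  qed
  consider "x = y" | "x < y" | "y < x" by linarith
  then show ?thesis
  proof cases
    case 2
    then have "x powr m < y powr m" using assms by (intro powr_less_mono2) auto
    then show ?thesis using *[of x y] 2 assms by (simp add: abs_if)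
  next
    case 3
    then have "y powr m < x powr m" using assms by (intro powr_less_mono2) auto
    then show ?thesis using *[of y x] 3 assms by (simp add: abs_if)
  qed simp
qed

lemma exponent_less_1:
  assumes "m < (real n - 2) / real n" and "n \<ge> 3"
  shows "m < 1"
proof -
  have "(real n - 2) / real n < 1" using assms(2) by (simp add: field_simps)
  then show ?thesis using assms(1) by linarith
qed

section \<open>Flux and logarithmic derivative at the origin\<close>

locale g_solution =
  fixes n :: nat and m \<beta>t \<eta> :: real and g \<psi> :: "real \<Rightarrow> real"
  assumes n: "n \<ge> 3" and m: "0 < m" "m < (real n - 2) / real n" and \<beta>t: "\<beta>t > 0" and \<eta>: "\<eta> > 0"
    and sys: "fde_system n m ((real n - 2) / m - real n) (alpha_t n m \<beta>t) \<beta>t g \<psi>"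
    and lim: "(g \<longlongrightarrow> \<eta>) (at_right 0)"
begin

definition "\<sigma> = (real n - 2) / m"
definition "q = \<sigma> - real n"
definition "\<gamma> = gamma1 n m"
text \<open>The same number appears as \<open>\<sigma> - 2 - \<gamma>\<close> in the derivative of
  the flux and as \<open>n - 2 - m \<gamma>\<close> at the lower barrier for \<psi>; its positivity
  decides the sign in both places.\<close>

definition "k = 2 * m / (1 - m)"

lemma n_pos: "real n - 1 > 0" "real n \<ge> 3" using n by auto

lemma nm: "real n * m < real n - 2" using m n by (simp add: field_simps)

lemma m_less_1: "m < 1"
  using m(2) n by (rule exponent_less_1)

lemma m_\<sigma>: "m * \<sigma> = real n - 2" using m by (simp add: \<sigma>_def)

lemma \<sigma>_gt: "\<sigma> > real n" using nm m by (simp add: \<sigma>_def pos_less_divide_eq)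

lemma q_pos: "q > 0" using \<sigma>_gt by (simp add: q_def)

lemma \<gamma>_eq: "(1 - m) * \<gamma> = q"
proof -
  have "(1 - m) * \<gamma> = \<sigma> - m * \<sigma> - 2"
    using m_less_1 by (simp add: \<gamma>_def gamma1_def \<sigma>_def[symmetric] field_simps)
  then show ?thesis by (simp add: m_\<sigma> q_def)
qed

lemma \<gamma>_pos: "\<gamma> > 0"
  using \<gamma>_eq q_pos m_less_1 by (metis diff_gt_0_iff_gt zero_less_mult_pos)

lemma k_pos: "k > 0" using m m_less_1 by (simp add: k_def)

lemma \<sigma>_\<gamma>: "\<sigma> - 2 - \<gamma> = k"
  using m_less_1 by (simp add: \<gamma>_def gamma1_def \<sigma>_def[symmetric] k_def field_simps)

lemma n_\<gamma>: "real n - 2 - m * \<gamma> = k"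
  using m_less_1 by (simp add: \<gamma>_def gamma1_def \<sigma>_def[symmetric] k_def right_diff_distrib m_\<sigma>)

lemma alpha_t_eq: "alpha_t n m \<beta>t = \<beta>t * \<gamma>"
  by (simp add: alpha_t_def \<gamma>_def gamma1_def)

lemma g_pos: "r > 0 \<Longrightarrow> g r > 0"
  and Dg: "r > 0 \<Longrightarrow> (g has_real_derivative g r * \<psi> r / r) (at r)"
  using sys by (auto simp: fde_system_def)

lemma D\<psi>: "r > 0 \<Longrightarrow> (\<psi> has_real_derivative
    - (m * (\<psi> r)\<^sup>2 + (real n - 2) * \<psi> r + g r powr (1 - m) * r powr q * \<beta>t * (\<gamma> + \<psi> r) / (real n - 1)) / r) (at r)"
  using sys by (simp add: fde_system_def alpha_t_eq q_def \<sigma>_def algebra_simps)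

lemma DU:
  assumes "r > 0" shows "((\<lambda>r. g r powr m) has_real_derivative m * g r powr m * \<psi> r / r) (at r)"
proof -
  have "((\<lambda>x. g x powr m) has_real_derivative m * g r powr (m - 1) * (g r * \<psi> r / r)) (at r)"
    using g_pos[OF assms] by (auto intro!: derivative_eq_intros Dg assms)
  moreover have "g r powr (m - 1) * g r = g r powr m"
    using g_pos[OF assms] by (simp add: powr_diff)
  ultimately show ?thesis by (simp add: mult.assoc[symmetric]) (simp add: mult.assoc)
qed

text \<open>By the equation \<open>\<beta>t (\<sigma> - 2) - \<alpha>t = \<beta>t k\<close>, so the derivative of this flux has a sign and
  involves no derivative of \<open>g\<close>.\<close>

definition "P r = (real n - 1) * r powr (real n - 2) * (g r powr m * \<psi> r) + \<beta>t * r powr (\<sigma> - 2) * g r"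

lemma DP:
  assumes r: "r > 0"
  shows "(P has_real_derivative \<beta>t * k * (r powr (\<sigma> - 2) / r) * g r) (at r)"
proof -
  define E where "E = r powr (real n - 2)"
  have C: "r powr (\<sigma> - 2) = E * r powr q" unfolding E_def q_def by (simp add: powr_add[symmetric])
  define V where "V = g r powr m"
  have V: "g r = V * g r powr (1 - m)"
    using g_pos[OF r] by (simp add: V_def powr_add[symmetric])
  define X where "X = g r powr (1 - m) * r powr q * \<beta>t * (\<gamma> + \<psi> r)"
  have "(P has_real_derivative
     ((real n - 1) * ((real n - 2) * (E / r))) * (V * \<psi> r)
     + (m * V * \<psi> r / r * \<psi> r + (- (m * (\<psi> r)\<^sup>2 + (real n - 2) * \<psi> r + X / (real n - 1)) / r) * V) * ((real n - 1) * E)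
     + (\<beta>t * ((\<sigma> - 2) * (r powr (\<sigma> - 2) / r)) * g r + g r * \<psi> r / r * (\<beta>t * r powr (\<sigma> - 2)))) (at r)"
    unfolding P_def[abs_def] E_def V_def X_def
    by (intro DERIV_add DERIV_mult DERIV_cmult DERIV_powr_const DU Dg D\<psi> r)
  also have "((real n - 1) * ((real n - 2) * (E / r))) * (V * \<psi> r)
     + (m * V * \<psi> r / r * \<psi> r + (- (m * (\<psi> r)\<^sup>2 + (real n - 2) * \<psi> r + X / (real n - 1)) / r) * V) * ((real n - 1) * E)
     + (\<beta>t * ((\<sigma> - 2) * (r powr (\<sigma> - 2) / r)) * g r + g r * \<psi> r / r * (\<beta>t * r powr (\<sigma> - 2)))
     = (- (V * X * E) + \<beta>t * r powr (\<sigma> - 2) * g r * (\<sigma> - 2 + \<psi> r)) / r"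
    using r n_pos by (simp add: field_simps power2_eq_square)
  also have "V * X * E = \<beta>t * r powr (\<sigma> - 2) * g r * (\<gamma> + \<psi> r)"
    unfolding X_def C by (subst V) (simp add: mult_ac)
  also have "(- (\<beta>t * r powr (\<sigma> - 2) * g r * (\<gamma> + \<psi> r)) + \<beta>t * r powr (\<sigma> - 2) * g r * (\<sigma> - 2 + \<psi> r)) / r
    = \<beta>t * (\<sigma> - 2 - \<gamma>) * (r powr (\<sigma> - 2) / r) * g r" by (simp add: algebra_simps diff_divide_distrib add_divide_distrib)
  finally show ?thesis unfolding \<sigma>_\<gamma> .
qed

lemma P_mono:
  assumes "0 < x" "x \<le> r" shows "P x \<le> P r"
proof (rule DERIV_nonneg_imp_nondecreasing[OF assms(2)])
  fix t assume "x \<le> t" "t \<le> r"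
  then have "t > 0" using assms by simp
  then show "\<exists>y. (P has_real_derivative y) (at t) \<and> 0 \<le> y"
    using \<beta>t k_pos g_pos[of t]
    by (intro exI[of _ "\<beta>t * k * (t powr (\<sigma> - 2) / t) * g t"] conjI DP) auto
qed

lemma \<psi>_P: "r > 0 \<Longrightarrow> (real n - 1) * r powr (real n - 2) * (g r powr m * \<psi> r) = P r - \<beta>t * r powr (\<sigma> - 2) * g r"
  by (simp add: P_def)

lemma g_near: "\<exists>r0>0. \<forall>r. 0 < r \<and> r < r0 \<longrightarrow> g r < 2 * \<eta>"
  using order_tendstoD(2)[OF lim, of "2 * \<eta>"] \<eta> by (auto simp: eventually_at_right_field)

text \<open>Since \<open>n \<ge> 3\<close>, one has \<open>r powr (n - 2) \<le> r\<close> on the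
  unit interval. Hence a flux bounded away from 0 forces a derivative of \<open>g powr m\<close> of
  order at least \<open>1/r^2\<close>.\<close>

lemma flux_bound:
  assumes r: "0 < r" "r \<le> 1" and e: "0 \<le> e" "e \<le> (real n - 1) * r powr (real n - 2) * X"
  shows "e * m / (real n - 1) / r\<^sup>2 \<le> m * X / r"
proof -
  have "r powr (real n - 2) \<le> r powr 1" using r n_pos by (intro powr_mono') auto
  then have a: "0 < r powr (real n - 2)" "r powr (real n - 2) \<le> r" using r by auto
  have "(real n - 1) * r powr (real n - 2) > 0" using n_pos(1) a(1) by (rule mult_pos_pos)
  then have "X \<ge> 0" using mult_pos_neg[of "(real n - 1) * r powr (real n - 2)" X] e by linarith
  then have "e \<le> (real n - 1) * r * X"
  proof -
    have "(real n - 1) * r powr (real n - 2) * X \<le> (real n - 1) * r * X"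
      using a \<open>X \<ge> 0\<close> n_pos by (intro mult_right_mono mult_left_mono) auto
    then show ?thesis using e(2) by linarith
  qed
  then have "e / (real n - 1) / r \<le> X"
    using n_pos r by (simp add: divide_le_eq mult_ac)
  then have "m * (e / (real n - 1) / r) / r \<le> m * X / r"
    using m r by (intro divide_right_mono mult_left_mono) auto
  then show ?thesis by (simp add: power2_eq_square mult_ac)
qed

text \<open>\<open>P\<close> is nondecreasing, so a negative value persists down to 0. Then the
  derivative of \<open>- (g powr m)\<close> is at least \<open>\<epsilon> / x^2\<close> near 0, and
  \<open>g\<close> would be unbounded there, against its limit.\<close>

lemma P_nonneg: assumes "r > 0" shows "P r \<ge> 0"
proof (rule ccontr)
  assume "\<not> P r \<ge> 0"
  obtain r2 where r2: "r2 > 0" "\<And>x. 0 < x \<Longrightarrow> x < r2 \<Longrightarrow> g x < 2 * \<eta>" using g_near by blast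
  define r0 where "r0 = min (min r 1) (r2 / 2)"
  define \<epsilon> where "\<epsilon> = - P r * m / (real n - 1)"
  have \<epsilon>: "\<epsilon> > 0" using \<open>\<not> P r \<ge> 0\<close> m n_pos by (simp add: \<epsilon>_def divide_neg_pos mult_neg_pos)
  have r0: "r0 > 0" using r2 assms by (simp add: r0_def)
  have "((\<lambda>r. - (g r powr m)) has_real_derivative - (m * g x powr m * \<psi> x / x)) (at x) \<and>
      - (m * g x powr m * \<psi> x / x) \<ge> \<epsilon> / x\<^sup>2" if x: "0 < x" "x \<le> r0" for x
  proof
    show "((\<lambda>r. - (g r powr m)) has_real_derivative - (m * g x powr m * \<psi> x / x)) (at x)"
      by (intro DERIV_minus DU x)
    have "P x \<le> P r" using x by (intro P_mono) (auto simp: r0_def)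
    moreover have "\<beta>t * x powr (\<sigma> - 2) * g x > 0" using \<beta>t x g_pos by simp
    ultimately have "(real n - 1) * x powr (real n - 2) * (g x powr m * \<psi> x) \<le> P r"
      unfolding \<psi>_P[OF x(1)] by simp
    then have "- P r \<le> (real n - 1) * x powr (real n - 2) * - (g x powr m * \<psi> x)" by simp
    from flux_bound[OF _ _ _ this]
    show "- (m * g x powr m * \<psi> x / x) \<ge> \<epsilon> / x\<^sup>2"
      using x \<open>\<not> P r \<ge> 0\<close> by (simp add: \<epsilon>_def r0_def mult.assoc)
  qed
  then obtain x where x: "0 < x" "x \<le> r0" "- (g x powr m) < - ((2 * \<eta>) powr m)"
    by (rule deriv_inverse_square_unbounded[OF \<epsilon> r0])
  have "x < r2" using x r2(1) by (simp add: r0_def)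
  then have "g x powr m < (2 * \<eta>) powr m"
    using r2(2) x m g_pos[of x] by (intro powr_less_mono2) auto
  then show False using x by simp
qed

lemma flux_lim: "((\<lambda>r. \<beta>t * r powr (\<sigma> - 2) * g r) \<longlongrightarrow> 0) (at_right 0)"
  using tendsto_mult[OF tendsto_mult[OF tendsto_const powr_lim] lim, of "\<sigma> - 2" \<beta>t] \<sigma>_gt n_pos by simp

text \<open>If \<open>P\<close> stayed above \<epsilon>, its first summand would be at least
  \<open>\<epsilon> / 2\<close> near 0, the second one being negligible, and \<open>g powr m\<close>
  would have to become negative. Monotonicity and the sign of \<open>P\<close> turn one small value
  into a limit.\<close>

lemma P_lim: "(P \<longlongrightarrow> 0) (at_right 0)"
proof (rule tendstoI)
  fix \<epsilon> :: real assume \<epsilon>: "\<epsilon> > 0"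
  have "\<exists>r>0. P r < \<epsilon>"
  proof (rule ccontr)
    assume "\<not> ?thesis"
    then have ge: "P r \<ge> \<epsilon>" if "r > 0" for r using that by force
    obtain r1 where r1: "r1 > 0" "\<And>x. 0 < x \<Longrightarrow> x < r1 \<Longrightarrow> \<beta>t * x powr (\<sigma> - 2) * g x < \<epsilon> / 2"
      using order_tendstoD(2)[OF flux_lim, of "\<epsilon> / 2"] \<epsilon> by (auto simp: eventually_at_right_field)
    define r0 where "r0 = min 1 (r1 / 2)"
    have r0: "r0 > 0" using r1 by (simp add: r0_def)
    have e: "\<epsilon> / 2 * m / (real n - 1) > 0" using \<epsilon> m n_pos by simp
    have "((\<lambda>r. g r powr m) has_real_derivative m * g x powr m * \<psi> x / x) (at x) \<and>
      m * g x powr m * \<psi> x / x \<ge> \<epsilon> / 2 * m / (real n - 1) / x\<^sup>2" if x: "0 < x" "x \<le> r0" for x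
    proof
      have "x < r1" using x r1(1) by (simp add: r0_def)
      then have "\<epsilon> / 2 \<le> (real n - 1) * x powr (real n - 2) * (g x powr m * \<psi> x)"
        unfolding \<psi>_P[OF x(1)] using r1(2)[of x] ge[of x] x by linarith
      from flux_bound[OF _ _ _ this]
      show "m * g x powr m * \<psi> x / x \<ge> \<epsilon> / 2 * m / (real n - 1) / x\<^sup>2"
        using x \<epsilon> by (simp add: r0_def mult.assoc)
    qed (intro DU x)
    then obtain x where x: "0 < x" "x \<le> r0" "g x powr m < 0"
      by (rule deriv_inverse_square_unbounded[OF e r0])
    then show False using powr_ge_zero[of "g x" m] by linarith
  qed
  then obtain r where "r > 0" "P r < \<epsilon>" by blast
  then have "\<bar>P x\<bar> < \<epsilon>" if "0 < x" "x < r" for x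
    using P_mono[of x r] P_nonneg[of x] that by simp
  then show "\<forall>\<^sub>F x in at_right 0. dist (P x) 0 < \<epsilon>"
    using \<open>r > 0\<close> by (auto simp: eventually_at_right_field)
qed

text \<open>Multiplied by \<open>- \<eta>\<close>, this becomes the limit prescribed in
  \<open>is_g\<close>; the factor \<open>m / (n - 1)\<close> there stems from
  \<open>m (\<sigma> - 2) = n - 2 - 2 m\<close>.\<close>

definition "c0 = \<beta>t * \<gamma> * \<eta> powr (1 - m) / ((\<sigma> - 2) * (real n - 1))"

lemma \<sigma>_2: "\<sigma> - 2 > 0" using \<sigma>_gt n_pos by simp

lemma c0_pos: "c0 > 0"
  using \<beta>t \<gamma>_pos \<eta> \<sigma>_2 n_pos by (simp add: c0_def)

text \<open>L'Hospital's rule gives the leading order of \<open>P\<close> from the limit of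
  \<open>g\<close> alone. Solving the definition of \<open>P\<close> for \<psi> and inserting
  \<open>k = \<sigma> - 2 - \<gamma>\<close> yields \<open>c0\<close>.\<close>

lemma \<psi>_asymp: "((\<lambda>r. r powr (- q) * \<psi> r) \<longlongrightarrow> - c0) (at_right 0)"
proof -
  have ev: "eventually (\<lambda>r::real. r > 0) (at_right 0)" by (rule eventually_at_right_less)
  have "((\<lambda>r. P r / r powr (\<sigma> - 2)) \<longlongrightarrow> \<beta>t * k * \<eta> / (\<sigma> - 2)) (at_right 0)"
  proof (rule lhopital_right_0[OF P_lim powr_lim[OF \<sigma>_2]])
    show "\<forall>\<^sub>F x in at_right 0. (P has_real_derivative \<beta>t * k * (x powr (\<sigma> - 2) / x) * g x) (at x)"
      using ev by eventually_elim (rule DP)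
    show "\<forall>\<^sub>F x in at_right 0. ((\<lambda>x. x powr (\<sigma> - 2)) has_real_derivative (\<sigma> - 2) * (x powr (\<sigma> - 2) / x)) (at x)"
      using ev by eventually_elim (rule DERIV_powr_const)
    show "\<forall>\<^sub>F x::real in at_right 0. x powr (\<sigma> - 2) \<noteq> 0"
      using ev by eventually_elim simp
    show "\<forall>\<^sub>F x::real in at_right 0. (\<sigma> - 2) * (x powr (\<sigma> - 2) / x) \<noteq> 0"
      using ev by eventually_elim (use \<sigma>_2 in simp)
    have "((\<lambda>x. \<beta>t * k * g x / (\<sigma> - 2)) \<longlongrightarrow> \<beta>t * k * \<eta> / (\<sigma> - 2)) (at_right 0)"
      using \<sigma>_2 by (intro tendsto_intros lim) auto
    then show "((\<lambda>x. \<beta>t * k * (x powr (\<sigma> - 2) / x) * g x / ((\<sigma> - 2) * (x powr (\<sigma> - 2) / x)))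
        \<longlongrightarrow> \<beta>t * k * \<eta> / (\<sigma> - 2)) (at_right 0)"
      by (rule Lim_transform_eventually) (use ev in eventually_elim, simp)
  qed
  then have "((\<lambda>r. (P r / r powr (\<sigma> - 2) - \<beta>t * g r) / ((real n - 1) * g r powr m)) \<longlongrightarrow>
      (\<beta>t * k * \<eta> / (\<sigma> - 2) - \<beta>t * \<eta>) / ((real n - 1) * \<eta> powr m)) (at_right 0)"
    using n_pos \<eta>
    by (intro tendsto_divide[OF tendsto_diff[OF _ tendsto_mult[OF tendsto_const lim]]
          tendsto_mult[OF tendsto_const tendsto_powr[OF lim tendsto_const]]]) auto
  also have "(\<beta>t * k * \<eta> / (\<sigma> - 2) - \<beta>t * \<eta>) / ((real n - 1) * \<eta> powr m) = - c0"
    unfolding \<sigma>_\<gamma>[symmetric] c0_def using \<eta> n_pos \<sigma>_2 by (simp add: powr_diff field_simps)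
  finally show ?thesis
  proof (rule Lim_transform_eventually)
    show "\<forall>\<^sub>F r in at_right 0. (P r / r powr (\<sigma> - 2) - \<beta>t * g r) / ((real n - 1) * g r powr m) = r powr (- q) * \<psi> r"
      using ev
    proof eventually_elim
      case (elim r)
      have C: "r powr (\<sigma> - 2) = r powr (real n - 2) * r powr q"
        unfolding q_def by (simp add: powr_add[symmetric])
      have "P r / r powr (\<sigma> - 2) - \<beta>t * g r = (real n - 1) * g r powr m * (r powr (- q) * \<psi> r)"
        using elim by (simp add: P_def add_divide_distrib) (simp add: C powr_minus field_simps)
      then show ?case using n_pos g_pos[OF elim] by simp
    qed
  qed
qed

lemma \<psi>_lim: "(\<psi> \<longlongrightarrow> 0) (at_right 0)"
proof (rule Lim_transform_eventually)
  show "((\<lambda>r. r powr q * (r powr (- q) * \<psi> r)) \<longlongrightarrow> 0) (at_right 0)"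
    using tendsto_mult[OF powr_lim[OF q_pos] \<psi>_asymp] by simp
  show "\<forall>\<^sub>F r in at_right 0. r powr q * (r powr (- q) * \<psi> r) = \<psi> r"
    using eventually_at_right_less[of 0] by eventually_elim (simp add: powr_minus field_simps)
qed

text \<open>The values 0 and - \<gamma> are barriers for \<psi>: at 0 only the term with the weight
  survives, at - \<gamma> that term vanishes and the quadratic part has the sign of
  \<open>k\<close>. Together they supply the positivity and the bound of \<open>y\<close> in the
  autonomous system.\<close>

lemma \<psi>_neg: assumes "r > 0" shows "\<psi> r < 0"
proof (rule neg_if_deriv_neg_at_zeros[OF D\<psi> _ _ assms])
  fix r :: real assume r: "r > 0" "\<psi> r = 0"
  then show "- (m * (\<psi> r)\<^sup>2 + (real n - 2) * \<psi> r + g r powr (1 - m) * r powr q * \<beta>t * (\<gamma> + \<psi> r) / (real n - 1)) / r < 0"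
    using g_pos[of r] \<beta>t \<gamma>_pos n_pos by (simp add: field_simps)
next
  have "\<forall>\<^sub>F r in at_right 0. r powr (- q) * \<psi> r < 0"
    using order_tendstoD(2)[OF \<psi>_asymp, of 0] c0_pos by simp
  then show "\<forall>\<^sub>F r in at_right 0. \<psi> r < 0"
    using eventually_at_right_less[of 0] by eventually_elim (simp add: mult_less_0_iff)
qed

lemma \<psi>_gt: assumes "r > 0" shows "\<psi> r > - \<gamma>"
proof -
  have "- \<gamma> - \<psi> r < 0"
  proof (rule neg_if_deriv_neg_at_zeros[OF DERIV_diff[OF DERIV_const D\<psi>] _ _ assms])
    fix r :: real assume r: "r > 0" "- \<gamma> - \<psi> r = 0"
    then have \<psi>: "\<psi> r = - \<gamma>" by simp
    have "0 - - (m * (\<psi> r)\<^sup>2 + (real n - 2) * \<psi> r + g r powr (1 - m) * r powr q * \<beta>t * (\<gamma> + \<psi> r) / (real n - 1)) / r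
      = - (\<gamma> * (real n - 2 - m * \<gamma>)) / r" using r(1) by (simp add: \<psi> field_simps power2_eq_square)
    also have "\<dots> < 0" using r(1) k_pos \<gamma>_pos by (simp add: n_\<gamma>)
    finally show "0 - - (m * (\<psi> r)\<^sup>2 + (real n - 2) * \<psi> r + g r powr (1 - m) * r powr q * \<beta>t * (\<gamma> + \<psi> r) / (real n - 1)) / r < 0" .
  next
    show "\<forall>\<^sub>F r in at_right 0. - \<gamma> - \<psi> r < 0"
      using order_tendstoD(1)[OF \<psi>_lim, of "- \<gamma>"] \<gamma>_pos by simp
  qed
  then show ?thesis by simp
qed

lemma g_antimono: assumes "0 < x" "x \<le> y" shows "g y \<le> g x"
proof (rule DERIV_nonpos_imp_nonincreasing[OF assms(2)])
  fix t assume "x \<le> t" "t \<le> y"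
  then have "t > 0" using assms by simp
  then show "\<exists>y. (g has_real_derivative y) (at t) \<and> y \<le> 0"
    using g_pos[of t] \<psi>_neg[of t]
    by (intro exI[of _ "g t * \<psi> t / t"] conjI Dg) (auto simp: mult_le_0_iff divide_le_0_iff)
qed

lemma g_le: assumes "r > 0" shows "g r \<le> \<eta>"
proof (rule tendsto_lowerbound[OF lim])
  show "\<forall>\<^sub>F x in at_right 0. g r \<le> g x"
    using g_antimono[of _ r] assms by (auto simp: eventually_at_right_field)
qed simp

lemma \<psi>_bound: obtains C where "C > 0" "\<And>r. r > 0 \<Longrightarrow> \<bar>\<psi> r\<bar> \<le> C * r powr q"
proof -
  have "\<forall>\<^sub>F r in at_right 0. r powr (- q) * \<psi> r > - (c0 + 1)"
    using order_tendstoD(1)[OF \<psi>_asymp] by simp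
  then obtain r0 where r0: "r0 > 0" "\<And>r. 0 < r \<Longrightarrow> r < r0 \<Longrightarrow> r powr (- q) * \<psi> r > - (c0 + 1)"
    by (auto simp: eventually_at_right_field)
  define C where "C = max (c0 + 1) (\<gamma> / r0 powr q)"
  have "\<bar>\<psi> r\<bar> \<le> C * r powr q" if r: "r > 0" for r
  proof (cases "r < r0")
    case True
    then have "- \<psi> r \<le> (c0 + 1) * r powr q"
      using r0(2)[OF r True] r by (simp add: powr_minus field_simps)
    also have "\<dots> \<le> C * r powr q" by (intro mult_right_mono) (auto simp: C_def)
    finally show ?thesis using \<psi>_neg[OF r] by simp
  next
    case False
    have "r0 powr q \<le> r powr q" using False r0 q_pos by (intro powr_mono2) auto
    then have "\<gamma> \<le> \<gamma> / r0 powr q * r powr q" using \<gamma>_pos r0(1) by (simp add: field_simps)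
    also have "\<dots> \<le> C * r powr q" by (intro mult_right_mono) (auto simp: C_def)
    finally show ?thesis using \<psi>_neg[OF r] \<psi>_gt[OF r] by simp
  qed
  moreover have "C > 0" using c0_pos by (simp add: C_def)
  ultimately show ?thesis using that by blast
qed

lemma g_diff: obtains C where "C > 0" "\<And>x y. 0 < y \<Longrightarrow> y \<le> x \<Longrightarrow> \<bar>g x - g y\<bar> \<le> C * (x powr q - y powr q)"
proof -
  obtain C where C: "C > 0" "\<And>r. r > 0 \<Longrightarrow> \<bar>\<psi> r\<bar> \<le> C * r powr q" using \<psi>_bound by metis
  have "\<bar>g x - g y\<bar> \<le> \<eta> * C / q * (x powr q - y powr q)" if xy: "0 < y" "y \<le> x" for x y
  proof -
    have "g y + \<eta> * C / q * y powr q \<le> g x + \<eta> * C / q * x powr q"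
    proof (rule DERIV_nonneg_imp_nondecreasing[OF xy(2)])
      fix t assume "y \<le> t" "t \<le> x"
      then have t: "t > 0" using xy by simp
      have "((\<lambda>r. g r + \<eta> * C / q * r powr q) has_real_derivative g t * \<psi> t / t + \<eta> * C * t powr q / t) (at t)"
        using t q_pos by (auto intro!: derivative_eq_intros Dg simp: powr_diff)
      moreover have "g t * - \<psi> t \<le> \<eta> * (C * t powr q)"
        using C(2)[OF t] g_le[OF t] g_pos[OF t] \<psi>_neg[OF t] by (intro mult_mono) auto
      then have "0 \<le> g t * \<psi> t / t + \<eta> * C * t powr q / t"
        using t by (simp add: add_divide_distrib[symmetric] mult.assoc)
      ultimately show "\<exists>d. ((\<lambda>r. g r + \<eta> * C / q * r powr q) has_real_derivative d) (at t) \<and> 0 \<le> d" by blast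
    qed
    then show ?thesis using g_antimono[OF xy] by (simp add: right_diff_distrib)
  qed
  moreover have "\<eta> * C / q > 0" using C \<eta> q_pos by simp
  ultimately show ?thesis using that by blast
qed

text \<open>The case distinction on \<open>m\<close> is the distinction between \<open>q > 1\<close>
  and \<open>q \<le> 1\<close>. As \<open>deriv g\<close> behaves like a multiple of
  \<open>r powr (q - 1)\<close>, it tends to 0 in the first case; in the second it does not, and a
  Hoelder bound takes the place of differentiability at 0.\<close>

lemma is_g:
  assumes g0: "g 0 = \<eta>"
  shows "is_g n m \<beta>t \<eta> g"
proof -
  have n2: "n \<ge> 2" and m0: "m \<noteq> 0" using n m by auto
  have base: "C2_pos g" "\<forall>r>0. g r > 0"
     "\<forall>r>0. fde_op n m g r + r powr ((real n - 2) / m - real n - 2) *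
        (alpha_t n m \<beta>t * g r + \<beta>t * r * deriv g r) = 0"
    using fde_system_iff[OF n2 m0, THEN iffD1, OF exI, OF sys] by blast+
  have q: "q = (real n - 2 - real n * m) / m" using m by (simp add: q_def \<sigma>_def field_simps)
  have dg: "deriv g r = g r * \<psi> r / r" if "r > 0" for r using Dg[OF that] by (rule DERIV_imp_deriv)
  have ev: "eventually (\<lambda>r::real. r > 0) (at_right 0)" by (rule eventually_at_right_less)
  obtain C where C: "C > 0" "\<And>x y. 0 < y \<Longrightarrow> y \<le> x \<Longrightarrow> \<bar>g x - g y\<bar> \<le> C * (x powr q - y powr q)"
    using g_diff by metis
  have C': "\<bar>g x - g y\<bar> \<le> C * (x powr q - y powr q)" if "0 \<le> y" "y \<le> x" for x y
  proof (cases "y = 0")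
    case False
    then show ?thesis using C(2) that by simp
  next
    case True
    show ?thesis
    proof (cases "x = 0")
      case False
      then have x: "x > 0" using that True by simp
      have "\<bar>g x - \<eta>\<bar> \<le> C * (x powr q - 0)"
      proof (rule tendsto_le[of "at_right 0"])
        show "((\<lambda>y. \<bar>g x - g y\<bar>) \<longlongrightarrow> \<bar>g x - \<eta>\<bar>) (at_right 0)" by (intro tendsto_intros lim)
        show "((\<lambda>y. C * (x powr q - y powr q)) \<longlongrightarrow> C * (x powr q - 0)) (at_right 0)"
          by (intro tendsto_intros powr_lim q_pos)
        show "\<forall>\<^sub>F y in at_right 0. \<bar>g x - g y\<bar> \<le> C * (x powr q - y powr q)"
          using C(2)[of _ x] x by (auto simp: eventually_at_right_field intro!: exI[of _ x])
      qed simp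
      then show ?thesis using True q_pos g0 by simp
    qed (use True in simp)
  qed
  have dlim: "((\<lambda>r. r powr (1 - q) * deriv g r) \<longlongrightarrow> \<eta> * - c0) (at_right 0)"
  proof (rule Lim_transform_eventually)
    show "((\<lambda>r. g r * (r powr (- q) * \<psi> r)) \<longlongrightarrow> \<eta> * - c0) (at_right 0)"
      by (intro tendsto_intros lim \<psi>_asymp)
    show "\<forall>\<^sub>F r in at_right 0. g r * (r powr (- q) * \<psi> r) = r powr (1 - q) * deriv g r"
      using ev by eventually_elim (simp add: dg powr_diff powr_minus_divide)
  qed
  show ?thesis
  proof (cases "m < (real n - 2) / (real n + 1)")
    case True
    then have q1: "q > 1" using m by (simp add: q field_simps)
    \<comment> \<open>At 0 \<open>deriv g\<close> would be a two-sided derivative; it is replaced by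
      the one-sided value 0.\<close>
    define G where "G r = (if r = 0 then 0 else deriv g r)" for r
    have "(deriv g \<longlongrightarrow> 0) (at_right 0)"
    proof (rule Lim_transform_eventually)
      show "((\<lambda>r. r powr (q - 1) * (r powr (1 - q) * deriv g r)) \<longlongrightarrow> 0) (at_right 0)"
        using tendsto_mult[OF powr_lim[of "q - 1"] dlim] q1 by simp
      show "\<forall>\<^sub>F r in at_right 0. r powr (q - 1) * (r powr (1 - q) * deriv g r) = deriv g r"
        using ev by eventually_elim (simp add: mult.assoc[symmetric] powr_add[symmetric])
    qed
    then have "(G \<longlongrightarrow> 0) (at_right 0)"
      by (rule Lim_transform_eventually) (use ev in eventually_elim, simp add: G_def)
    then have "(G \<longlongrightarrow> G 0) (at 0 within {0..})"
      by (simp add: at_within_Ici_at_right G_def)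
    moreover have "(G \<longlongrightarrow> G r) (at r within {0..})" if "r > 0" for r
    proof -
      have "isCont (deriv g) r" using base(1) that unfolding C2_pos_def
        by (auto intro: differentiable_imp_continuous_within)
      then have "(deriv g \<longlongrightarrow> deriv g r) (at r within {0..})"
        by (auto simp: isCont_def intro: tendsto_within_subset)
      then have "(deriv g \<longlongrightarrow> G r) (at r within {0..})" using that by (simp add: G_def)
      moreover have "eventually (\<lambda>x. x \<in> {0<..}) (at r within {0..})"
        using that filter_leD[OF at_le[OF subset_UNIV] eventually_at_in_open'[of "{0<..}" r]] by simp
      then have "\<forall>\<^sub>F x in at r within {0..}. deriv g x = G x"
        by eventually_elim (auto simp: G_def)
      ultimately show ?thesis by (rule Lim_transform_eventually)
    qed
    ultimately have cont: "continuous_on {0..} G"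
      unfolding continuous_on_def by (metis atLeast_iff le_less)
    have "(g has_real_derivative G 0) (at 0 within {0..})"
    proof -
      have "((\<lambda>x. (g x - g 0) / (x - 0)) \<longlongrightarrow> 0) (at_right 0)"
      proof (rule Lim_null_comparison)
        show "((\<lambda>x. C * x powr (q - 1)) \<longlongrightarrow> 0) (at_right 0)"
          using tendsto_mult[OF tendsto_const powr_lim[of "q - 1"], of C] q1 by simp
        show "\<forall>\<^sub>F x in at_right 0. norm ((g x - g 0) / (x - 0)) \<le> C * x powr (q - 1)"
          using ev
        proof eventually_elim
          case (elim x)
          then show ?case using C'[of 0 x] q_pos by (simp add: powr_diff divide_right_mono)
        qed
      qed
      then show ?thesis
        by (simp add: has_field_derivative_iff at_within_Ici_at_right G_def)
    qed
    moreover have "(g has_real_derivative G r) (at r within {0..})" if "r > 0" for r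
      using Dg[OF that] dg[OF that] that by (auto simp: G_def intro: has_field_derivative_at_within)
    ultimately have "\<forall>r\<ge>0. (g has_real_derivative G r) (at r within {0..})"
      by (metis le_less)
    moreover have "G 0 = 0" by (simp add: G_def)
    ultimately show ?thesis using base g0 cont True by (auto simp: is_g_def)
  next
    case False
    then have q1: "q \<le> 1" using m by (simp add: q field_simps)
    have d0: "delta0 n m = q / 2" and d1: "delta1 n m = 1 - q"
      by (auto simp: delta0_def delta1_def q)
    \<comment> \<open>The prescribed exponent is \<open>q / 2\<close>, not the natural
      \<open>q\<close>, and for distant points a smaller exponent is the stronger demand. The bound
      with exponent \<open>q\<close> is therefore combined with the uniform bound \<eta>; their
      geometric mean has exponent \<open>q / 2\<close>.\<close>
    have *: "\<bar>g x - g y\<bar> \<le> sqrt (\<eta> * C) * (x - y) powr (q / 2)" if xy: "0 \<le> y" "y \<le> x" for x y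
    proof -
      have "0 \<le> g r" "g r \<le> \<eta>" if "r \<ge> 0" for r
        using that g0 g_pos[of r] g_le[of r] \<eta> by (cases "r = 0"; force)+
      from this[of x] this[of y] xy have "\<bar>g x - g y\<bar> \<le> \<eta>" by (simp add: abs_le_iff)
      moreover have "\<bar>g x - g y\<bar> \<le> C * (x - y) powr q"
        using C'[OF xy] mult_left_mono[OF powr_diff_le[OF q_pos q1 xy], of C] C(1) by linarith
      ultimately have "\<bar>g x - g y\<bar> * \<bar>g x - g y\<bar> \<le> \<eta> * (C * (x - y) powr q)"
        using \<eta> by (intro mult_mono) auto
      then have "\<bar>g x - g y\<bar> \<le> sqrt (\<eta> * C * (x - y) powr q)"
        by (intro real_le_rsqrt) (simp add: power2_eq_square mult.assoc)
      also have "\<dots> = sqrt (\<eta> * C) * (x - y) powr (q / 2)"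
        using xy by (simp add: real_sqrt_mult powr_half_sqrt[symmetric] powr_powr)
      finally show ?thesis .
    qed
    have "\<bar>g x - g y\<bar> \<le> sqrt (\<eta> * C) * \<bar>x - y\<bar> powr (q / 2)" if "0 \<le> x" "0 \<le> y" for x y
      using that *[of y x] *[of x y] by (cases "y \<le> x") (auto simp: abs_minus_commute)
    then have "holder_on (delta0 n m) {0..} g"
      unfolding holder_on_def d0 by (intro exI[of _ "sqrt (\<eta> * C)"]) auto
    moreover have "\<eta> * - c0 = - (m / (real n - 1)) * (alpha_t n m \<beta>t * \<eta> powr (2 - m) / (real n - 2 - 2 * m))"
    proof -
      have "real n - 2 - 2 * m = m * (\<sigma> - 2)" using m by (simp add: \<sigma>_def field_simps)
      moreover have "\<eta> powr (2 - m) = \<eta> * \<eta> powr (1 - m)"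
        using \<eta> powr_add[of \<eta> 1 "1 - m"] by simp
      moreover have "x * (\<beta>t * \<gamma> * E / (s * N)) = m / N * (\<beta>t * \<gamma> * (x * E) / (m * s))"
        if "s > 0" "N > 0" for x E s N :: real
        using that m by (simp add: field_simps)
      from this[OF \<sigma>_2 n_pos(1), of \<eta> "\<eta> powr (1 - m)"]
      have "\<eta> * c0 = m / (real n - 1) * (\<beta>t * \<gamma> * (\<eta> * \<eta> powr (1 - m)) / (m * (\<sigma> - 2)))"
        by (simp only: c0_def)
      ultimately show ?thesis by (simp add: alpha_t_eq)
    qed
    ultimately show ?thesis using base g0 False dlim by (simp add: is_g_def d1)
  qed
qed

end

text \<open>A contraction in the norm \<open>sup |\<delta>| / e\<close> with a growing exponential
  weight. A bound on \<delta> passes to \<open>g1 - g2\<close>, from there to the difference of the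
  fluxes, then of \<open>g powr m * \<psi>\<close>, and returns to \<delta> halved. The weight makes
  this work on the whole half line at once, without continuation from small to large
  \<open>r\<close>.\<close>

lemma g_solution_unique:
  assumes 1: "g_solution n m \<beta>t \<eta> g1 \<psi>1" and 2: "g_solution n m \<beta>t \<eta> g2 \<psi>2" and R: "R > 0"
  shows "g1 R = g2 R"
proof -
  interpret A: g_solution n m \<beta>t \<eta> g1 \<psi>1 by fact
  interpret B: g_solution n m \<beta>t \<eta> g2 \<psi>2 by fact
  define \<sigma> where "\<sigma> = A.\<sigma>"
  define q where "q = A.q"
  define k where "k = A.k"
  note pos = A.\<sigma>_2[folded \<sigma>_def] A.q_pos[folded q_def] A.k_pos[folded k_def] A.n_pos(1) A.m(1) A.\<eta> A.\<beta>t
  define C where "C = \<eta> powr (1 - m) / m"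
  \<comment> \<open>\<open>M\<close> collects the constants of one such pass: the derivative of
    \<delta> is bounded by \<open>N M (r powr q / r) e\<close>, which is \<open>N / 2\<close> times
    the derivative of \<open>e\<close>. The factor 2 in the exponent of \<open>e\<close> is the
    source of the contraction.\<close>
  define M where "M = m * C * \<beta>t * (k / (\<sigma> - 2) + 1) / (real n - 1)"
  define e where "e r = exp (2 * M / q * r powr q)" for r
  define \<delta> where "\<delta> r = g1 r powr m - g2 r powr m" for r
  have C: "C > 0" using pos by (simp add: C_def)
  have M: "M > 0" using pos C by (simp add: M_def add_pos_pos)
  have De: "(e has_real_derivative 2 * M * (r powr q / r) * e r) (at r)" if "r > 0" for r
    unfolding e_def[abs_def]
    by (rule derivative_eq_intros DERIV_powr_const[OF that] refl)+ (use pos in simp)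
  have e_lim: "(e \<longlongrightarrow> 1) (at_right 0)"
    unfolding e_def[abs_def]
    using tendsto_exp[OF tendsto_mult[OF tendsto_const powr_lim[OF pos(2)]], of "2 * M / q"] by simp
  have e_pos: "e r > 0" for r by (simp add: e_def)
  have gd: "\<bar>g1 r - g2 r\<bar> \<le> C * \<bar>\<delta> r\<bar>" if "r > 0" for r
    unfolding C_def \<delta>_def using that A.m A.m_less_1
    by (intro abs_diff_le_powr_diff A.g_pos B.g_pos A.g_le B.g_le)
  have half: "\<bar>\<delta> r\<bar> \<le> N / 2 * e r" if N: "N \<ge> 0" "\<And>r. r > 0 \<Longrightarrow> \<bar>\<delta> r\<bar> \<le> N * e r" and r: "r > 0" for N r
  proof -
    have gN: "\<bar>g1 r - g2 r\<bar> \<le> C * N * e r" if "r > 0" for r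
    proof -
      have "C * \<bar>\<delta> r\<bar> \<le> C * (N * e r)" using N(2)[OF that] C by (intro mult_left_mono) auto
      from order_trans[OF gd[OF that] this] show ?thesis by (simp only: mult.assoc)
    qed
    define c where "c = \<beta>t * k * C * N / (\<sigma> - 2)"
    have c: "c \<ge> 0" using pos C N(1) by (simp add: c_def)
    have Pd: "\<bar>A.P r - B.P r\<bar> \<le> c * (r powr (\<sigma> - 2) * e r)" if r: "r > 0" for r
    proof (rule abs_le_if_deriv_le[where R = r and F = "\<lambda>r. A.P r - B.P r" and G = "\<lambda>r. c * (r powr (\<sigma> - 2) * e r)"])
      fix t assume t: "0 < t" "t \<le> r"
      let ?F = "\<beta>t * k * (t powr (\<sigma> - 2) / t) * g1 t - \<beta>t * k * (t powr (\<sigma> - 2) / t) * g2 t"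
      let ?G = "c * ((\<sigma> - 2) * (t powr (\<sigma> - 2) / t) * e t + 2 * M * (t powr q / t) * e t * t powr (\<sigma> - 2))"
      show "((\<lambda>r. A.P r - B.P r) has_real_derivative ?F) (at t)"
        unfolding \<sigma>_def k_def by (intro DERIV_diff A.DP B.DP t)
      show "((\<lambda>r. c * (r powr (\<sigma> - 2) * e r)) has_real_derivative ?G) (at t)"
        by (intro DERIV_cmult DERIV_mult DERIV_powr_const De t)
      have "\<bar>?F\<bar> = \<beta>t * k * (t powr (\<sigma> - 2) / t) * \<bar>g1 t - g2 t\<bar>"
        unfolding right_diff_distrib[symmetric] abs_mult using pos t by simp
      also have "\<dots> \<le> \<beta>t * k * (t powr (\<sigma> - 2) / t) * (C * N * e t)"
        using pos t by (intro mult_left_mono gN) auto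
      also have "\<dots> = c * ((\<sigma> - 2) * (t powr (\<sigma> - 2) / t) * e t)"
        using pos by (simp add: c_def)
      \<comment> \<open>The contribution from the derivative of \<open>e\<close> is nonnegative and
        is dropped; the growth of \<open>r powr (\<sigma> - 2)\<close> alone absorbs the
        source.\<close>
      also have "\<dots> \<le> ?G"
        using c M t e_pos[of t] by (intro mult_left_mono) auto
      finally show "\<bar>?F\<bar> \<le> ?G" .
    next
      show "((\<lambda>r. A.P r - B.P r) \<longlongrightarrow> 0) (at_right 0)"
        using tendsto_diff[OF A.P_lim B.P_lim] by simp
      show "((\<lambda>r. c * (r powr (\<sigma> - 2) * e r)) \<longlongrightarrow> 0) (at_right 0)"
        using tendsto_mult[OF tendsto_const tendsto_mult[OF powr_lim[OF pos(1)] e_lim], of c] by simp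
    qed (use r in auto)
    define X1 where "X1 r = g1 r powr m * \<psi>1 r" for r
    define X2 where "X2 r = g2 r powr m * \<psi>2 r" for r
    have XX: "\<bar>X1 r - X2 r\<bar> \<le> \<beta>t * (k / (\<sigma> - 2) + 1) * C * N / (real n - 1) * (r powr q * e r)" if r: "r > 0" for r
    proof -
      have s2: "r powr (\<sigma> - 2) = r powr (real n - 2) * r powr q"
        unfolding q_def A.q_def \<sigma>_def by (simp add: powr_add[symmetric])
      have "(real n - 1) * r powr (real n - 2) * \<bar>X1 r - X2 r\<bar> =
        \<bar>(real n - 1) * r powr (real n - 2) * X1 r - (real n - 1) * r powr (real n - 2) * X2 r\<bar>"
        unfolding right_diff_distrib[symmetric] abs_mult using pos by simp
      also have "\<dots> = \<bar>(A.P r - B.P r) - \<beta>t * r powr (\<sigma> - 2) * (g1 r - g2 r)\<bar>"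
        unfolding X1_def X2_def A.\<psi>_P[OF r] B.\<psi>_P[OF r] by (simp add: \<sigma>_def algebra_simps)
      also have "\<dots> \<le> \<bar>A.P r - B.P r\<bar> + \<bar>\<beta>t * r powr (\<sigma> - 2) * (g1 r - g2 r)\<bar>" by (rule abs_triangle_ineq4)
      also have "\<bar>\<beta>t * r powr (\<sigma> - 2) * (g1 r - g2 r)\<bar> = \<beta>t * r powr (\<sigma> - 2) * \<bar>g1 r - g2 r\<bar>"
        unfolding abs_mult using pos by simp
      also have "\<bar>A.P r - B.P r\<bar> + \<dots> \<le> c * (r powr (\<sigma> - 2) * e r) + \<beta>t * r powr (\<sigma> - 2) * (C * N * e r)"
        using pos by (intro add_mono Pd r mult_left_mono gN) auto
      also have "\<dots> = (real n - 1) * r powr (real n - 2) *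
          (\<beta>t * (k / (\<sigma> - 2) + 1) * C * N / (real n - 1) * (r powr q * e r))"
      proof -
        have "\<beta>t * k * C * N / d * (x * y * z) + \<beta>t * (x * y) * (C * N * z)
          = l * x * (\<beta>t * (k / d + 1) * C * N / l * (y * z))" if "d > 0" "l > 0" for d l x y z :: real
          using that by (simp add: field_simps)
        from this[OF pos(1,4)] show ?thesis unfolding c_def s2 .
      qed
      finally show ?thesis by (rule mult_left_le_imp_le) (use pos r in simp)
    qed
    have "\<bar>\<delta> r\<bar> \<le> N / 2 * (e r - 1)"
    proof (rule abs_le_if_deriv_le[where R = r and F = \<delta> and G = "\<lambda>r. N / 2 * (e r - 1)"])
      fix t assume t: "0 < t" "t \<le> r"
      show "(\<delta> has_real_derivative m * g1 t powr m * \<psi>1 t / t - m * g2 t powr m * \<psi>2 t / t) (at t)"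
        unfolding \<delta>_def[abs_def] by (intro DERIV_diff A.DU B.DU t)
      show "((\<lambda>r. N / 2 * (e r - 1)) has_real_derivative N / 2 * (2 * M * (t powr q / t) * e t - 0)) (at t)"
        by (intro DERIV_cmult DERIV_diff De DERIV_const t)
      have "\<bar>m * g1 t powr m * \<psi>1 t / t - m * g2 t powr m * \<psi>2 t / t\<bar> = m / t * \<bar>X1 t - X2 t\<bar>"
      proof -
        have "m * g1 t powr m * \<psi>1 t / t - m * g2 t powr m * \<psi>2 t / t = m / t * (X1 t - X2 t)"
          by (simp add: X1_def X2_def right_diff_distrib)
        then show ?thesis using pos t by (simp add: abs_mult)
      qed
      also have "\<dots> \<le> m / t * (\<beta>t * (k / (\<sigma> - 2) + 1) * C * N / (real n - 1) * (t powr q * e t))"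
        using pos t by (intro mult_left_mono XX) auto
      also have "\<dots> = N / 2 * (2 * M * (t powr q / t) * e t - 0)"
      proof -
        have "m / t * (\<beta>t * K * C * N / l * (x * z)) = N / 2 * (2 * (m * C * \<beta>t * K / l) * (x / t) * z - 0)"
          for K l x z :: real by (simp add: mult_ac)
        from this show ?thesis unfolding M_def .
      qed
      finally show "\<bar>m * g1 t powr m * \<psi>1 t / t - m * g2 t powr m * \<psi>2 t / t\<bar> \<le>
          N / 2 * (2 * M * (t powr q / t) * e t - 0)" .
    next
      have "(\<delta> \<longlongrightarrow> \<eta> powr m - \<eta> powr m) (at_right 0)"
        unfolding \<delta>_def[abs_def] using pos by (intro tendsto_diff tendsto_powr A.lim B.lim tendsto_const) auto
      then show "(\<delta> \<longlongrightarrow> 0) (at_right 0)" by simp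
      have "((\<lambda>r. N / 2 * (e r - 1)) \<longlongrightarrow> N / 2 * (1 - 1)) (at_right 0)"
        by (intro tendsto_mult tendsto_diff tendsto_const e_lim)
      then show "((\<lambda>r. N / 2 * (e r - 1)) \<longlongrightarrow> 0) (at_right 0)" by simp
    qed (use r in auto)
    then show ?thesis using N(1) by (simp add: right_diff_distrib)
  qed
  have all: "\<bar>\<delta> r\<bar> \<le> \<eta> powr m * (1 / 2) ^ j * e r" if "r > 0" for r j
    using that
  proof (induction j arbitrary: r)
    case 0
    have "g1 r powr m \<le> \<eta> powr m" "g2 r powr m \<le> \<eta> powr m"
      using A.g_le[OF 0] A.g_pos[OF 0] B.g_le[OF 0] B.g_pos[OF 0] pos by (auto intro!: powr_mono2)
    then have "\<bar>\<delta> r\<bar> \<le> \<eta> powr m"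
      unfolding \<delta>_def using powr_ge_zero[of "g1 r" m] powr_ge_zero[of "g2 r" m] by linarith
    also have "\<dots> \<le> \<eta> powr m * e r"
      using M pos by (simp add: e_def)
    finally show ?case by simp
  next
    case (Suc j)
    show ?case using half[of "\<eta> powr m * (1 / 2) ^ j" r, OF _ Suc.IH Suc.prems] by simp
  qed
  have "(\<lambda>j. \<eta> powr m * (1 / 2) ^ j * e R) \<longlonglongrightarrow> \<eta> powr m * 0 * e R"
    by (intro tendsto_intros LIMSEQ_realpow_zero) auto
  then have "\<bar>\<delta> R\<bar> \<le> \<eta> powr m * 0 * e R"
    by (rule LIMSEQ_le_const) (use all[OF R] in auto)
  then show ?thesis using gd[OF R] by simp
qed

text \<open>Either form of regularity in \<open>is_g\<close> implies continuity at 0, and with it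
  the common setting in which uniqueness is proved.\<close>

lemma is_g_imp_g_solution:
  assumes n: "n \<ge> 3" and m: "0 < m" "m < (real n - 2) / real n" and \<beta>t: "\<beta>t > 0" and \<eta>: "\<eta> > 0"
    and g: "is_g n m \<beta>t \<eta> g"
  obtains \<psi> where "g_solution n m \<beta>t \<eta> g \<psi>"
proof -
  have n2: "n \<ge> 2" and m0: "m \<noteq> 0" using n m by auto
  have "C2_pos g" "\<forall>r>0. g r > 0"
     "\<forall>r>0. fde_op n m g r + r powr ((real n - 2) / m - real n - 2) *
        (alpha_t n m \<beta>t * g r + \<beta>t * r * deriv g r) = 0" and g0: "g 0 = \<eta>"
    using g by (auto simp: is_g_def)
  then obtain \<psi> where sys: "fde_system n m ((real n - 2) / m - real n) (alpha_t n m \<beta>t) \<beta>t g \<psi>"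
    using fde_system_iff[OF n2 m0] by blast
  have "(g \<longlongrightarrow> \<eta>) (at_right 0)"
  proof (cases "m < (real n - 2) / (real n + 1)")
    case True
    then obtain g' where "\<And>r. r \<ge> 0 \<Longrightarrow> (g has_real_derivative g' r) (at r within {0..})"
      using g by (auto simp: is_g_def)
    from DERIV_continuous[OF this[OF order_refl]] show ?thesis
      by (simp add: continuous_within at_within_Ici_at_right g0)
  next
    case False
    then obtain C where C: "\<And>x y. x \<ge> 0 \<Longrightarrow> y \<ge> 0 \<Longrightarrow> \<bar>g x - g y\<bar> \<le> C * \<bar>x - y\<bar> powr delta0 n m"
      using g unfolding is_g_def holder_on_def by (metis atLeast_iff)
    have d0: "delta0 n m > 0"
      using n m by (simp add: delta0_def delta1_def field_simps)
    have "((\<lambda>x. g x - \<eta>) \<longlongrightarrow> 0) (at_right 0)"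
    proof (rule Lim_null_comparison)
      have "((\<lambda>x::real. x powr delta0 n m) \<longlongrightarrow> 0) (at_right 0)"
        using d0 by (rule powr_lim)
      from tendsto_mult[OF tendsto_const this, of C]
      show "((\<lambda>x. C * x powr delta0 n m) \<longlongrightarrow> 0) (at_right 0)" by simp
      show "\<forall>\<^sub>F x in at_right 0. norm (g x - \<eta>) \<le> C * x powr delta0 n m"
        using eventually_at_right_less[of 0] by eventually_elim (use C[of _ 0] g0 in force)
    qed
    then show ?thesis by (simp add: LIM_zero_iff)
  qed
  with n m \<beta>t \<eta> sys show ?thesis by (intro that[of \<psi>]) (simp add: g_solution_def)
qed

section \<open>Identification of g and passage to the autonomous system\<close>

context g_solution begin

text \<open>Existence for the definite description is witnessed by the solution in hand, uniqueness
  comes from the contraction; the values at 0 and on the negative axis are matched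
  separately.\<close>

lemma g_sol_eq:
  assumes "g 0 = \<eta>" "\<And>r. r < 0 \<Longrightarrow> g r = 0"
  shows "g_sol n m \<beta>t \<eta> = g"
  unfolding g_sol_def
proof (rule the_equality)
  show "is_g n m \<beta>t \<eta> g \<and> (\<forall>r<0. g r = 0)" using assms is_g by simp
  fix h assume h: "is_g n m \<beta>t \<eta> h \<and> (\<forall>r<0. h r = 0)"
  then obtain \<phi> where "g_solution n m \<beta>t \<eta> h \<phi>"
    using is_g_imp_g_solution[OF n m \<beta>t \<eta>] by metis
  then have "h r = g r" if "r > 0" for r
    by (rule g_solution_unique[OF _ g_solution_axioms that])
  moreover have "h 0 = g 0" using h assms(1) by (simp add: is_g_def)
  ultimately show "h = g" using h assms(2) by (metis ext linorder_neqE)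
qed

text \<open>The constants come from \<open>y = (1 - m) (\<gamma> + \<psi>)\<close>. The weighted
  term contains \<open>\<gamma> + \<psi>\<close> because \<open>alpha_t\<close> is
  \<open>\<beta>t * \<gamma>\<close>, hence it is proportional to \<open>w y\<close>; the constant
  term is \<open>(1 - m) \<gamma> (n - 2 - m \<gamma>)\<close>, which equals
  \<open>2 m \<gamma>\<close> by \<open>(1 - m) k = 2 m\<close>.\<close>

lemma wy_system:
  "wy_system (\<lambda>s. exp (q * s) * g (exp s) powr (1 - m)) (\<lambda>s. (1 - m) * (\<gamma> + \<psi> (exp s)))
     (m * \<gamma>) (2 * m * \<gamma> - (real n - 2)) (m / (1 - m)) (\<beta>t / (real n - 1)) ((1 - m) * \<gamma>)"
proof
  show "m * \<gamma> > 0" using m \<gamma>_pos by simp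
  show "\<beta>t / (real n - 1) > 0" using \<beta>t n_pos by simp
  fix s :: real
  have s: "exp s > 0" by simp
  define G where "G = g (exp s) powr (1 - m)"
  define p where "p = \<psi> (exp s)"
  have G: "G > 0" using g_pos[OF s] by (simp add: G_def)
  show "exp (q * s) * g (exp s) powr (1 - m) > 0" using G by (simp add: G_def)
  show "(1 - m) * (\<gamma> + \<psi> (exp s)) > 0" "(1 - m) * (\<gamma> + \<psi> (exp s)) \<le> (1 - m) * \<gamma>"
    using \<psi>_gt[OF s] \<psi>_neg[OF s] m_less_1 by (auto intro!: mult_pos_pos mult_left_mono)
  have "((\<lambda>x. g x powr (1 - m)) has_real_derivative (1 - m) * g (exp s) powr (1 - m - 1) * (g (exp s) * p / exp s)) (at (exp s))"
    using g_pos[OF s] unfolding p_def by (auto intro!: derivative_eq_intros Dg)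
  also have "(1 - m) * g (exp s) powr (1 - m - 1) * (g (exp s) * p / exp s) = (1 - m) * G * p / exp s"
    using g_pos[OF s] by (simp add: G_def powr_diff powr_minus_divide)
  finally have DG: "((\<lambda>x. g x powr (1 - m)) has_real_derivative (1 - m) * G * p / exp s) (at (exp s))" .
  have "((\<lambda>s. exp (q * s) * g (exp s) powr (1 - m)) has_real_derivative
      exp (q * s) * q * G + (1 - m) * G * p / exp s * exp s * exp (q * s)) (at s)"
    unfolding G_def
    by (intro DERIV_mult DERIV_chain2[where f = "\<lambda>x. g x powr (1 - m)" and g = exp, OF DG[unfolded G_def] DERIV_exp])
       (auto intro!: derivative_eq_intros)
  also have "exp (q * s) * q * G + (1 - m) * G * p / exp s * exp s * exp (q * s) = exp (q * s) * G * ((1 - m) * (\<gamma> + p))"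
  proof -
    have "(1 - m) * G * p / exp s * exp s = (1 - m) * G * p" by simp
    then show ?thesis unfolding distrib_left[of "1 - m"] \<gamma>_eq by (simp add: distrib_left mult_ac)
  qed
  finally show "((\<lambda>s. exp (q * s) * g (exp s) powr (1 - m)) has_real_derivative
      exp (q * s) * g (exp s) powr (1 - m) * ((1 - m) * (\<gamma> + \<psi> (exp s)))) (at s)"
    by (simp add: G_def p_def)
  have powr: "exp s powr q = exp (q * s)" by (simp add: powr_def)
  define W where "W = exp (q * s) * G"
  have "((\<lambda>s. (1 - m) * (\<gamma> + \<psi> (exp s))) has_real_derivative (1 - m) * (0 +
     - (m * p\<^sup>2 + (real n - 2) * p + W * \<beta>t * (\<gamma> + p) / (real n - 1)) / exp s * exp s)) (at s)"
    unfolding p_def W_def G_def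
    by (intro DERIV_cmult DERIV_add DERIV_const)
       (use DERIV_chain2[where f = \<psi> and g = exp, OF D\<psi>[OF s] DERIV_exp] in \<open>simp add: powr mult_ac\<close>)
  also have "(1 - m) * (0 + - (m * p\<^sup>2 + (real n - 2) * p + W * \<beta>t * (\<gamma> + p) / (real n - 1)) / exp s * exp s)
    = - (1 - m) * (m * p\<^sup>2 + (real n - 2) * p) - \<beta>t / (real n - 1) * W * ((1 - m) * (\<gamma> + p))"
    using n_pos by (simp add: field_simps)
  also have "- (1 - m) * (m * p\<^sup>2 + (real n - 2) * p)
    = 2 * (m * \<gamma>) + (2 * m * \<gamma> - (real n - 2)) * ((1 - m) * (\<gamma> + p)) - m / (1 - m) * ((1 - m) * (\<gamma> + p))\<^sup>2"
  proof -
    have k: "(1 - m) * k = 2 * m" using m_less_1 by (simp add: k_def)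
    have e1: "m / (1 - m) * ((1 - m) * (\<gamma> + p))\<^sup>2 = (1 - m) * m * (\<gamma> + p)\<^sup>2"
      using m_less_1 by (simp add: power2_eq_square)
    have e2: "2 * (m * \<gamma>) = (1 - m) * (real n - 2 - m * \<gamma>) * \<gamma>"
      unfolding n_\<gamma> k by simp
    show ?thesis unfolding e1 e2 by (simp add: algebra_simps power2_eq_square)
  qed
  finally show "((\<lambda>s. (1 - m) * (\<gamma> + \<psi> (exp s))) has_real_derivative
       2 * (m * \<gamma>) + (2 * m * \<gamma> - (real n - 2)) * ((1 - m) * (\<gamma> + \<psi> (exp s)))
       - m / (1 - m) * ((1 - m) * (\<gamma> + \<psi> (exp s)))\<^sup>2
       - \<beta>t / (real n - 1) * (exp (q * s) * g (exp s) powr (1 - m)) * ((1 - m) * (\<gamma> + \<psi> (exp s)))) (at s)"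
    by (simp add: p_def W_def G_def)
qed

end

section \<open>The expansion at the origin\<close>

definition log_profile :: "real \<Rightarrow> (real \<Rightarrow> real) \<Rightarrow> real \<Rightarrow> real" where
  "log_profile m f s = exp (- 2 * s) * f (exp (- s)) powr (1 - m)"

text \<open>The autonomous system is set up for \<open>g\<close>, the expansion is wanted for
  \<open>f\<close>; since the exponents add up to -2, both lead to the same
  \<open>w\<close>.\<close>

lemma log_profile_inversion:
  assumes m: "0 < m" and f: "f (exp (- s)) > 0"
  shows "exp (((real n - 2) / m - real n) * s) * inversion n m A f (exp s) powr (1 - m) = log_profile m f s"
proof -
  have e: "(real n - 2) / m - real n + - ((real n - 2) / m) * (1 - m) = - 2"
    using m by (simp add: field_simps)
  have "inversion n m A f (exp s) = exp (- ((real n - 2) / m) * s) * f (exp (- s))"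
    by (simp add: inversion_def powr_def exp_minus inverse_eq_divide)
  then have "inversion n m A f (exp s) powr (1 - m)
      = exp (- ((real n - 2) / m) * s) powr (1 - m) * f (exp (- s)) powr (1 - m)"
    using f by (simp only: powr_mult exp_ge_zero less_imp_le)
  also have "exp (- ((real n - 2) / m) * s) powr (1 - m) = exp (- ((real n - 2) / m) * s * (1 - m))"
    by (simp add: powr_def mult_ac)
  finally have "inversion n m A f (exp s) powr (1 - m)
      = exp (- ((real n - 2) / m) * s * (1 - m)) * f (exp (- s)) powr (1 - m)" .
  then have "exp (((real n - 2) / m - real n) * s) * inversion n m A f (exp s) powr (1 - m)
      = exp (((real n - 2) / m - real n) * s + - ((real n - 2) / m) * s * (1 - m)) * f (exp (- s)) powr (1 - m)"
    by (simp only: exp_add mult.assoc)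
  also have "((real n - 2) / m - real n) * s + - ((real n - 2) / m) * s * (1 - m)
      = ((real n - 2) / m - real n + - ((real n - 2) / m) * (1 - m)) * s"
  proof -
    have "x * s + y * s * z = (x + y * z) * s" for x y z :: real by (simp add: algebra_simps)
    then show ?thesis .
  qed
  finally show ?thesis unfolding e log_profile_def .
qed

text \<open>On the logarithmic scale a dilation is a translation by \<open>ln b\<close>; the
  remaining factor is later absorbed by the change of \<open>slope\<close>.\<close>

lemma log_profile_scale:
  assumes "a > 0" "f (b * exp (- s)) > 0" "b > 0"
  shows "log_profile m (\<lambda>r. a * f (b * r)) s = a powr (1 - m) / b\<^sup>2 * log_profile m f (s - ln b)"
proof -
  have b: "exp (- (s - ln b)) = b * exp (- s)" using assms by (simp add: exp_diff exp_minus field_simps)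
  have "exp (- 2 * (s - ln b)) = (exp (- (s - ln b)))\<^sup>2" by (simp add: exp_double[symmetric])
  also have "\<dots> = b\<^sup>2 * exp (- 2 * s)" unfolding b by (simp add: power_mult_distrib exp_double[symmetric])
  finally have e: "exp (- 2 * (s - ln b)) = b\<^sup>2 * exp (- 2 * s)" .
  show ?thesis
    unfolding log_profile_def e b using assms by (simp add: powr_mult)
qed

lemma is_f_pos: "is_f n m \<beta> A f \<Longrightarrow> r > 0 \<Longrightarrow> f r > 0"
  by (simp add: is_f_def Let_def)

lemma is_f_g_solution:
  assumes n: "n \<ge> 3" and m: "0 < m" "m < (real n - 2) / real n" and "A > 0" "\<beta> < 0"
    and f: "is_f n m \<beta> A f"
  obtains \<psi> where "g_solution n m (- \<beta>) A (inversion n m A f) \<psi>"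
proof -
  have n2: "n \<ge> 2" and m0: "m \<noteq> 0" using n m by auto
  have m_less_1: "m < 1" using m(2) n by (rule exponent_less_1)
  obtain \<phi> where "fde_system n m 2 (2 * \<beta> / (1 - m)) \<beta> f \<phi>"
    and lim: "((\<lambda>r. r powr ((real n - 2) / m) * f r) \<longlongrightarrow> A) at_top"
    using f is_f_iff[OF n2 m0] by auto
  then have "fde_system n m ((real n - 2) / m - real n) (alpha_t n m (- \<beta>)) (- \<beta>)
      (inversion n m A f) (\<lambda>r. - ((real n - 2) / m) - \<phi> (1 / r))"
    using fde_system_inversion m m_less_1 by blast
  then show ?thesis
    using inversion_tendsto[OF lim] assms by (intro that) (simp add: g_solution_def)
qed

section \<open>The constants of the expansion\<close>

context
  fixes n :: nat and m :: real
  assumes n: "n \<ge> 3" and m: "0 < m" "m < (real n - 2) / real n"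
begin

definition "gap = real n - 2 - real n * m"
text \<open>In the notation of the autonomous system, \<rho> is \<open>b / (2 a)\<close>,
  \<open>slope\<close> is \<open>c\<close>, and \<open>gap / (1 - m)\<close> is
  \<open>a\<close>.\<close>

definition "\<rho> = (real n - 2 - (real n + 2) * m) / (2 * gap)"
definition "slope \<beta> = 2 * (real n - 1) * gap / ((1 - m) * \<bar>\<beta>\<bar>)"

lemma gap_pos: "gap > 0" using m n by (simp add: gap_def field_simps)

lemma m_less_1: "m < 1"
  using m(2) n by (rule exponent_less_1)

lemma gamma1_eq: "gamma1 n m = gap / (m * (1 - m))"
  using m m_less_1 by (simp add: gamma1_def gap_def field_simps)

lemma log_profile_expansion:
  assumes A: "A > 0" and \<beta>: "\<beta> < 0" and f: "is_f n m \<beta> A f"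
  obtains L where
    "((\<lambda>s. log_profile m f s / slope \<beta> - s - \<rho> * ln s) \<longlongrightarrow> L) at_top"
    "((\<lambda>s. s * (log_profile m f s / slope \<beta> - s - \<rho> * ln s - L - \<rho>\<^sup>2 * (ln s / s)))
       \<longlongrightarrow> \<rho> * L - (1 - 2 * m) / (2 * gap)) at_top"
proof -
  obtain \<psi> where "g_solution n m (- \<beta>) A (inversion n m A f) \<psi>"
    using is_f_g_solution[OF n m A \<beta> f] by metis
  then interpret G: g_solution n m "- \<beta>" A "inversion n m A f" \<psi> .
  interpret W: wy_system "\<lambda>s. exp (G.q * s) * inversion n m A f (exp s) powr (1 - m)"
    "\<lambda>s. (1 - m) * (G.\<gamma> + \<psi> (exp s))" "m * G.\<gamma>" "2 * m * G.\<gamma> - (real n - 2)" "m / (1 - m)"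
    "- \<beta> / (real n - 1)" "(1 - m) * G.\<gamma>"
    by (rule G.wy_system)
  have w: "exp (G.q * s) * inversion n m A f (exp s) powr (1 - m) = log_profile m f s" for s
    unfolding G.q_def G.\<sigma>_def by (rule log_profile_inversion[OF m(1) is_f_pos[OF f]]) simp
  have a: "m * G.\<gamma> = gap / (1 - m)"
    using m m_less_1 by (simp add: G.\<gamma>_def gamma1_eq)
  have \<rho>: "(2 * m * G.\<gamma> - (real n - 2)) / (2 * (m * G.\<gamma>)) = \<rho>"
  proof -
    have "2 * m * G.\<gamma> - (real n - 2) = (2 * gap - (real n - 2) * (1 - m)) / (1 - m)"
      using a m_less_1 by (simp add: field_simps)
    also have "2 * gap - (real n - 2) * (1 - m) = real n - 2 - (real n + 2) * m"
      by (simp add: gap_def algebra_simps)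
    finally show ?thesis unfolding a \<rho>_def using m_less_1 gap_pos by simp
  qed
  have c: "W.c = slope \<beta>"
  proof -
    have "W.c = 2 * (m * G.\<gamma>) / (- \<beta> / (real n - 1))" by (simp only: W.c_def)
    then show ?thesis
      using \<beta> m_less_1 G.n_pos unfolding a slope_def by (simp add: field_simps)
  qed
  have p: "(1 - m / (1 - m)) / (2 * (m * G.\<gamma>)) = (1 - 2 * m) / (2 * gap)"
    unfolding a using m_less_1 gap_pos by (simp add: field_simps)
  show ?thesis
    using W.normalized_expansion[unfolded w \<rho> c p] that by blast
qed

text \<open>\<open>h1\<close> is \<open>slope (- 1)\<close> times the normalised remainder, whose
  convergence is already known; so \<open>Lim\<close> in the definition of \<open>K\<close> denotes
  a genuine limit.\<close>

lemma K0_limit: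
  assumes f: "is_f n m (- 1) 1 f"
  shows "((\<lambda>s. log_profile m f s / slope (- 1) - s - \<rho> * ln s) \<longlongrightarrow> K0 n m) at_top"
proof -
  obtain \<psi> where "g_solution n m (- (- 1)) 1 (inversion n m 1 f) \<psi>"
    using is_f_g_solution[OF n m _ _ f] by (metis less_minus_one_simps(1) zero_less_one)
  then interpret G: g_solution n m 1 1 "inversion n m 1 f" \<psi> by simp
  have gs: "g_sol n m 1 1 = inversion n m 1 f"
    by (rule G.g_sol_eq) (auto simp: inversion_def)
  have w: "w_t n m 1 1 s = log_profile m f s" for s
  proof -
    have "(1 - m) * (alpha_t n m 1 / 1) = (real n - 2) / m - real n"
      using G.\<gamma>_eq by (simp add: G.alpha_t_eq G.q_def G.\<sigma>_def)
    then show ?thesis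
      unfolding w_t_def gs using log_profile_inversion[OF m(1) is_f_pos[OF f], where s = s and n = n and A = 1] by simp
  qed
  obtain L where L: "((\<lambda>s. log_profile m f s / slope (- 1) - s - \<rho> * ln s) \<longlongrightarrow> L) at_top"
    using log_profile_expansion[OF _ _ f] by (metis less_minus_one_simps(1) zero_less_one)
  have sl: "slope (- 1) > 0" using m_less_1 gap_pos G.n_pos by (simp add: slope_def)
  have slope: "slope (- 1) = 2 * (real n - 1) * (real n - 2 - real n * m) / ((1 - m) * 1)"
    by (simp add: slope_def gap_def)
  have \<rho>: "slope (- 1) * \<rho> = (real n - 1) * (real n - 2 - (real n + 2) * m) / ((1 - m) * 1)"
  proof -
    have "2 * N * d / ((1 - m) * \<bar>- 1\<bar>) * (S / (2 * d)) = N * S / ((1 - m) * 1)" if "d > 0" for N d S :: real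
      using that by simp
    from this[OF gap_pos] show ?thesis unfolding slope_def \<rho>_def .
  qed
  have "h1 n m 1 1 s = slope (- 1) * (log_profile m f s / slope (- 1) - s - \<rho> * ln s)" for s
    unfolding h1_def h0_def w slope[symmetric] \<rho>[symmetric] using sl by (simp add: right_diff_distrib)
  then have h1: "(h1 n m 1 1 \<longlongrightarrow> slope (- 1) * L) at_top"
    using tendsto_mult[OF tendsto_const L, of "slope (- 1)"] by presburger
  have "K n m 1 1 = slope (- 1) * L"
  proof (cases "m = (real n - 2) / (real n + 2)")
    case True
    \<comment> \<open>In the exceptional case the coefficient of the logarithm vanishes, so
      \<open>h1\<close> and \<open>h0\<close> coincide and both branches of \<open>K\<close> give
      the same value.\<close>
    then have "real n - 2 - (real n + 2) * m = 0" by simp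
    then have "h1 n m 1 1 = h0 n m 1 1" by (simp add: h1_def[abs_def])
    then show ?thesis using tendsto_Lim[OF _ h1] True by (simp add: K_def)
  next
    case False
    then show ?thesis using tendsto_Lim[OF _ h1] by (simp add: K_def)
  qed
  then have "K0 n m = L"
    using m_less_1 gap_pos G.n_pos by (simp add: K0_def slope_def gap_def[symmetric])
  then show ?thesis using L by simp
qed

text \<open>With \<open>b = e\<^sup>L\<close> and \<open>a = b\<^bsup>(n-2)/m\<^esup>/A\<close> the rescaled profile \<open>a f(b r)\<close> is
  \<open>f\<^bsub>-1,1\<^esub>\<close>.\<close>

lemma log_profile_shift:
  assumes A: "A > 0" and \<beta>: "\<beta> < 0" and f: "is_f n m \<beta> A f"
  defines "L \<equiv> (ln A + ln (- \<beta>) / (1 - m)) / gamma1 n m"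
  shows "((\<lambda>s. log_profile m f s / slope \<beta> - s - \<rho> * ln s) \<longlongrightarrow> K0 n m + L) at_top"
proof -
  define \<sigma> where "\<sigma> = (real n - 2) / m"
  define b where "b = exp L"
  define a where "a = exp (\<sigma> * L - ln A)"
  have ab: "a > 0" "b > 0" by (auto simp: a_def b_def)
  have \<gamma>: "gamma1 n m > 0" using gamma1_eq gap_pos m m_less_1 by simp
  \<comment> \<open>Origin of the shift: eliminating \<open>a\<close> from the two normalisations,
    \<open>a * b powr - \<sigma> * A = 1\<close> and
    \<open>- \<beta> * (b\<^sup>2 * a powr (m - 1)) = 1\<close>, leaves this linear equation for
    \<open>ln b\<close>.\<close>
  have L: "(1 - m) * gamma1 n m * L = (1 - m) * ln A + ln (- \<beta>)"
    using m_less_1 \<gamma> by (simp add: L_def field_simps)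
  have \<gamma>\<sigma>: "(1 - m) * gamma1 n m = (1 - m) * \<sigma> - 2"
  proof -
    have "(1 - m) * (2 / (1 - m)) = 2" using m_less_1 by (simp add: field_simps)
    then show ?thesis by (simp only: gamma1_def \<sigma>_def right_diff_distrib)
  qed
  have exponent: "2 * L + (m - 1) * (\<sigma> * L - ln A) = - ln (- \<beta>)"
    using L unfolding \<gamma>\<sigma> by (simp add: algebra_simps)
  have b2: "b\<^sup>2 = exp (2 * L)" by (simp add: b_def exp_double[symmetric])
  have ap: "a powr e = exp (e * (\<sigma> * L - ln A))" for e by (simp add: a_def powr_def)
  have ba: "b\<^sup>2 * a powr (m - 1) = 1 / - \<beta>"
    unfolding b2 ap exp_add[symmetric] exponent using \<beta> by (simp add: exp_minus inverse_eq_divide)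
  have "a * b powr - \<sigma> * A = 1"
    using A by (simp add: a_def b_def powr_def exp_diff exp_minus)
  then have F: "is_f n m (- 1) 1 (\<lambda>r. a * f (b * r))"
    using is_f_scale[OF _ m(1) m_less_1 f ab] n \<beta> by (simp add: ba \<sigma>_def)
  have "a powr (1 - m) / b\<^sup>2 = - \<beta>"
  proof -
    have "a powr (1 - m) = 1 / a powr (m - 1)" using ab by (simp add: powr_minus_divide[symmetric])
    then have "a powr (1 - m) / b\<^sup>2 = 1 / (b\<^sup>2 * a powr (m - 1))" by simp
    then show ?thesis unfolding ba by simp
  qed
  then have lp: "log_profile m (\<lambda>r. a * f (b * r)) s = - \<beta> * log_profile m f (s - L)" for s
    using log_profile_scale[of a f b s m] ab is_f_pos[OF f] by (simp add: b_def)
  have "slope (- 1) = - \<beta> * slope \<beta>"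
    using \<beta> by (simp add: slope_def)
  then have quot: "log_profile m (\<lambda>r. a * f (b * r)) s / slope (- 1) = log_profile m f (s - L) / slope \<beta>" for s
    using \<beta> by (simp add: lp)
  have "filterlim (\<lambda>s. L + s) at_top at_top"
    by (rule filterlim_tendsto_add_at_top[OF tendsto_const filterlim_ident])
  from filterlim_compose[OF K0_limit[OF F] this]
  have 1: "((\<lambda>s. log_profile m f s / slope \<beta> - (L + s) - \<rho> * ln (L + s)) \<longlongrightarrow> K0 n m) at_top"
    by (simp add: quot)
  \<comment> \<open>The translation changes \<open>ln s\<close> only by
    \<open>ln (1 + L / s)\<close>, which vanishes in the limit; so only the constant term moves, by
    \<open>L\<close>.\<close>
  have 2: "((\<lambda>s. ln (1 + L / s)) \<longlongrightarrow> ln (1 + 0)) at_top"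
    by (intro tendsto_intros tendsto_divide_0[OF tendsto_const] filterlim_at_top_imp_at_infinity filterlim_ident) auto
  have "((\<lambda>s. log_profile m f s / slope \<beta> - (L + s) - \<rho> * ln (L + s) + L + \<rho> * ln (1 + L / s))
      \<longlongrightarrow> K0 n m + L + \<rho> * ln (1 + 0)) at_top"
    by (intro tendsto_add tendsto_mult 1 2 tendsto_const)
  then have "((\<lambda>s. log_profile m f s / slope \<beta> - (L + s) - \<rho> * ln (L + s) + L + \<rho> * ln (1 + L / s))
      \<longlongrightarrow> K0 n m + L) at_top" by simp
  then show ?thesis
  proof (rule Lim_transform_eventually)
    show "\<forall>\<^sub>F s in at_top. log_profile m f s / slope \<beta> - (L + s) - \<rho> * ln (L + s) + L + \<rho> * ln (1 + L / s)
        = log_profile m f s / slope \<beta> - s - \<rho> * ln s"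
      using eventually_gt_at_top[of "\<bar>L\<bar>"]
    proof eventually_elim
      case (elim s)
      then have "1 + L / s = (L + s) / s" "L + s > 0" "s > 0" by (auto simp: field_simps)
      then show ?case by (simp add: ln_div right_diff_distrib)
    qed
  qed
qed

text \<open>The squared terms of \<open>a1\<close> and \<open>a2\<close> cancel. What remains is the
  coefficient of \<open>1/s\<close> that belongs to the constant term \<open>K0\<close>, that is, to
  \<beta> = -1 and \<open>A = 1\<close>.\<close>

lemma a1_eq: "a1 n m = \<rho> * K0 n m - (1 - 2 * m) / (2 * gap)"
proof -
  define S where "S = real n - 2 - (real n + 2) * m"
  define N where "N = real n - 1"
  have N: "N > 0" using n by (simp add: N_def)
  have "S\<^sup>2 / (4 * d\<^sup>2) - t\<^sup>2 * (2 * (1 - 2 * m) * N * d / t\<^sup>2 + N * S\<^sup>2 / t\<^sup>2 - S / t * k * 1) / (4 * N * d\<^sup>2)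
      = S / (2 * d) * (t * k / (2 * N * d)) - (1 - 2 * m) / (2 * d)"
    if "d > 0" "t > 0" for d t k :: real
    using that N by (simp add: field_simps power2_eq_square)
  from this[OF gap_pos, of "1 - m" "K n m 1 1"] m_less_1 show ?thesis
    by (simp add: a1_def a2_def K0_def \<rho>_def S_def N_def gap_def[symmetric])
qed

lemma is_f_expansion:
  assumes A: "A > 0" and \<beta>: "\<beta> < 0" and f: "is_f n m \<beta> A f"
  shows "\<exists>e \<in> o[at_right 0](\<lambda>r. 1 / ln (1 / r)). \<forall>\<^sub>F r in at_right 0.
        f r powr (1 - m) =
          2 * (real n - 1) * (real n - 2 - real n * m) / ((1 - m) * \<bar>\<beta>\<bar> * r\<^sup>2) *
          (ln (1 / r)
           + (real n - 2 - (real n + 2) * m) / (2 * (real n - 2 - real n * m)) * ln (ln (1 / r))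
           + K0 n m + 1 / gamma1 n m * ln A
           + m / (real n - 2 - real n * m) * ln \<bar>\<beta>\<bar>
           + a3 n m A (- \<beta>) / ln (1 / r)
           + (real n - 2 - (real n + 2) * m)\<^sup>2 / (4 * (real n - 2 - real n * m)\<^sup>2)
               * (ln (ln (1 / r)) / ln (1 / r))
           + e r)"
proof -
  define L where "L = (ln A + ln (- \<beta>) / (1 - m)) / gamma1 n m"
  have \<gamma>: "gamma1 n m > 0" using gamma1_eq gap_pos m m_less_1 by simp
  obtain L' where L': "((\<lambda>s. log_profile m f s / slope \<beta> - s - \<rho> * ln s) \<longlongrightarrow> L') at_top"
    and exp: "((\<lambda>s. s * (log_profile m f s / slope \<beta> - s - \<rho> * ln s - L' - \<rho>\<^sup>2 * (ln s / s)))
       \<longlongrightarrow> \<rho> * L' - (1 - 2 * m) / (2 * gap)) at_top"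
    by (rule log_profile_expansion[OF A \<beta> f])
  \<comment> \<open>The expansion carries an unidentified constant term. The shift computes it, and
    uniqueness of limits transfers its value to the coefficient of \<open>1/s\<close> as
    well.\<close>
  have "L' = K0 n m + L"
    using tendsto_unique[OF _ L' log_profile_shift[OF A \<beta> f]] by (simp add: L_def)
  moreover have "L = 1 / gamma1 n m * ln A + m / gap * ln \<bar>\<beta>\<bar>"
    unfolding L_def gamma1_eq using \<beta> m(1) m_less_1 gap_pos by (simp add: field_simps)
  ultimately have const: "K0 n m + 1 / gamma1 n m * ln A + m / (real n - 2 - real n * m) * ln \<bar>\<beta>\<bar> = L'"
    unfolding gap_def by linarith
  have "ln (A * (- \<beta>) powr (1 / (1 - m))) = gamma1 n m * L"
    using A \<beta> \<gamma> by (simp add: L_def ln_mult ln_powr)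
  then have "a3 n m A (- \<beta>) = a1 n m + \<rho> * L"
    using \<gamma> by (simp add: a3_def \<rho>_def gap_def)
  then have a3: "a3 n m A (- \<beta>) = \<rho> * L' - (1 - 2 * m) / (2 * gap)"
    using \<open>L' = K0 n m + L\<close> by (simp add: a1_eq distrib_left)
  have \<rho>2: "(real n - 2 - (real n + 2) * m)\<^sup>2 / (4 * (real n - 2 - real n * m)\<^sup>2) = \<rho>\<^sup>2"
    by (simp only: \<rho>_def gap_def power_divide power_mult_distrib) simp
  \<comment> \<open>With \<open>E\<close> as the exact remainder the identity for \<open>f\<close>
    holds by construction, and only the order of \<open>E\<close> has to be proved.\<close>
  define E where "E s = log_profile m f s / slope \<beta>
      - (s + \<rho> * ln s + L' + a3 n m A (- \<beta>) / s + \<rho>\<^sup>2 * (ln s / s))" for s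
  define e where "e r = E (ln (1 / r))" for r
  have "((\<lambda>s. s * (log_profile m f s / slope \<beta> - s - \<rho> * ln s - L' - \<rho>\<^sup>2 * (ln s / s)) - a3 n m A (- \<beta>))
     \<longlongrightarrow> 0) at_top"
    using tendsto_diff[OF exp tendsto_const[of "a3 n m A (- \<beta>)"]] by (simp add: a3)
  then have "((\<lambda>s. s * E s) \<longlongrightarrow> 0) at_top"
  proof (rule Lim_transform_eventually)
    show "\<forall>\<^sub>F s in at_top. s * (log_profile m f s / slope \<beta> - s - \<rho> * ln s - L' - \<rho>\<^sup>2 * (ln s / s)) - a3 n m A (- \<beta>)
        = s * E s"
      using eventually_gt_at_top[of 0] by eventually_elim (simp add: E_def right_diff_distrib distrib_left)
  qed
  moreover have lnr: "filterlim (\<lambda>r::real. ln (1 / r)) at_top (at_right 0)"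
    using filterlim_compose[OF ln_at_top filterlim_inverse_at_top_right] by (simp add: inverse_eq_divide)
  ultimately have lim: "((\<lambda>r. ln (1 / r) * e r) \<longlongrightarrow> 0) (at_right 0)"
    unfolding e_def by (rule filterlim_compose)
  have pos: "\<forall>\<^sub>F r::real in at_right 0. ln (1 / r) > 0"
    using lnr by (simp add: filterlim_at_top_dense)
  have "e \<in> o[at_right 0](\<lambda>r. 1 / ln (1 / r))"
  proof (rule smalloI_tendsto)
    show "((\<lambda>r. e r / (1 / ln (1 / r))) \<longlongrightarrow> 0) (at_right 0)"
      using lim by (simp add: mult.commute)
    show "\<forall>\<^sub>F r::real in at_right 0. 1 / ln (1 / r) \<noteq> 0"
      using pos by eventually_elim simp
  qed
  moreover have "\<forall>\<^sub>F r in at_right 0. f r powr (1 - m) =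
      2 * (real n - 1) * (real n - 2 - real n * m) / ((1 - m) * \<bar>\<beta>\<bar> * r\<^sup>2) *
      (ln (1 / r) + \<rho> * ln (ln (1 / r)) + L' + a3 n m A (- \<beta>) / ln (1 / r)
       + \<rho>\<^sup>2 * (ln (ln (1 / r)) / ln (1 / r)) + e r)"
    using eventually_at_right_less[of 0]
  proof eventually_elim
    case (elim r)
    have "exp (- ln (1 / r)) = r" using elim by (simp add: ln_div)
    moreover have "exp (- 2 * ln (1 / r)) = r\<^sup>2"
      using elim by (simp add: ln_div exp_double)
    ultimately have lp: "log_profile m f (ln (1 / r)) = r\<^sup>2 * f r powr (1 - m)"
      by (simp add: log_profile_def)
    have sl: "slope \<beta> > 0"
      unfolding slope_def using m_less_1 gap_pos n \<beta> by (intro divide_pos_pos mult_pos_pos) auto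
    have "ln (1 / r) + \<rho> * ln (ln (1 / r)) + L' + a3 n m A (- \<beta>) / ln (1 / r)
       + \<rho>\<^sup>2 * (ln (ln (1 / r)) / ln (1 / r)) + e r = r\<^sup>2 * f r powr (1 - m) / slope \<beta>"
      by (simp add: e_def E_def lp)
    moreover have "2 * (real n - 1) * (real n - 2 - real n * m) / ((1 - m) * \<bar>\<beta>\<bar> * r\<^sup>2) = slope \<beta> / r\<^sup>2"
      by (simp add: slope_def gap_def)
    ultimately show ?case using elim sl by simp
  qed
  ultimately show ?thesis
    unfolding \<rho>2 \<rho>_def[unfolded gap_def, symmetric] const[symmetric]
    by (intro bexI[of _ e]) (simp_all add: add.assoc)
qed

end

theorem theorem1p3:
  fixes n :: nat and m lam A \<beta> \<beta>t :: real and f f1 :: "real \<Rightarrow> real"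
  assumes "n \<ge> 3" and "0 < m" and "m < (real n - 2) / real n"
    and "lam > 0" and "A > 0" and "\<beta> < 0" and "\<beta>t = - \<beta>"
    and f: "is_f n m \<beta> A f"
    and f1: "is_f n m \<beta> 1 f1"
  shows
    "(\<exists>e \<in> o[at_right 0](\<lambda>r. 1 / ln (1 / r)). \<forall>\<^sub>F r in at_right 0.
        f r powr (1 - m) =
          2 * (real n - 1) * (real n - 2 - real n * m) / ((1 - m) * \<bar>\<beta>\<bar> * r\<^sup>2) *
          (ln (1 / r)
           + (real n - 2 - (real n + 2) * m) / (2 * (real n - 2 - real n * m)) * ln (ln (1 / r))
           + K0 n m + 1 / gamma1 n m * ln A
           + m / (real n - 2 - real n * m) * ln \<bar>\<beta>\<bar>
           + a3 n m A \<beta>t / ln (1 / r)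
           + (real n - 2 - (real n + 2) * m)\<^sup>2 / (4 * (real n - 2 - real n * m)\<^sup>2)
               * (ln (ln (1 / r)) / ln (1 / r))
           + e r)) \<and>
     (\<exists>e \<in> o[at_right 0](\<lambda>r. 1 / ln (1 / r)). \<forall>\<^sub>F r in at_right 0.
        f_scaled m lam f1 r powr (1 - m) =
          2 * (real n - 1) * (real n - 2 - real n * m) / ((1 - m) * \<bar>\<beta>\<bar> * r\<^sup>2) *
          (ln (1 / r)
           + (real n - 2 - (real n + 2) * m) / (2 * (real n - 2 - real n * m)) * ln (ln (1 / r))
           + K0 n m - ln lam
           + m / (real n - 2 - real n * m) * ln \<bar>\<beta>\<bar>
           + a3 n m (lam powr (- gamma1 n m)) \<beta>t / ln (1 / r)
           + (real n - 2 - (real n + 2) * m)\<^sup>2 / (4 * (real n - 2 - real n * m)\<^sup>2)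
               * (ln (ln (1 / r)) / ln (1 / r))
           + e r))"
proof
  note nm = assms(1-3)
  show "\<exists>e \<in> o[at_right 0](\<lambda>r. 1 / ln (1 / r)). \<forall>\<^sub>F r in at_right 0.
        f r powr (1 - m) =
          2 * (real n - 1) * (real n - 2 - real n * m) / ((1 - m) * \<bar>\<beta>\<bar> * r\<^sup>2) *
          (ln (1 / r)
           + (real n - 2 - (real n + 2) * m) / (2 * (real n - 2 - real n * m)) * ln (ln (1 / r))
           + K0 n m + 1 / gamma1 n m * ln A
           + m / (real n - 2 - real n * m) * ln \<bar>\<beta>\<bar>
           + a3 n m A \<beta>t / ln (1 / r)
           + (real n - 2 - (real n + 2) * m)\<^sup>2 / (4 * (real n - 2 - real n * m)\<^sup>2)
               * (ln (ln (1 / r)) / ln (1 / r))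
           + e r)"
    unfolding \<open>\<beta>t = - \<beta>\<close> by (rule is_f_expansion[OF nm \<open>A > 0\<close> \<open>\<beta> < 0\<close> f])
  have m_less_1: "m < 1" by (rule m_less_1[OF nm])
  \<comment> \<open>With this factor the dilation keeps \<beta> and changes the limit at infinity
    from 1 to \<open>lam powr (- gamma1 n m)\<close>. So the second expansion is an instance of the
    first, and \<open>ln A / gamma1\<close> becomes \<open>- ln lam\<close>.\<close>
  define a where "a = lam powr (2 / (1 - m))"
  have a: "a > 0" using \<open>lam > 0\<close> by (simp add: a_def)
  have "lam\<^sup>2 * a powr (m - 1) = 1"
  proof -
    have "2 / (1 - m) * (m - 1) = - 2" using m_less_1 by (simp add: field_simps)
    then have "a powr (m - 1) = lam powr - 2" by (simp only: a_def powr_powr)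
    then show ?thesis using \<open>lam > 0\<close> by (simp add: powr_minus_divide)
  qed
  moreover have "a * lam powr (- ((real n - 2) / m)) * 1 = lam powr (- gamma1 n m)"
    by (simp add: a_def powr_add[symmetric] gamma1_def)
  ultimately have "is_f n m \<beta> (lam powr (- gamma1 n m)) (f_scaled m lam f1)"
    using is_f_scale[OF _ assms(2) m_less_1 f1 a \<open>lam > 0\<close>] nm
    by (simp add: f_scaled_def[abs_def] a_def)
  note * = is_f_expansion[OF nm _ \<open>\<beta> < 0\<close> this]
  have "gamma1 n m > 0"
    using gamma1_eq[OF nm] gap_pos[OF nm] m_less_1 assms(2) by simp
  then have "1 / gamma1 n m * ln (lam powr (- gamma1 n m)) = - ln lam"
    using \<open>lam > 0\<close> by (simp add: ln_powr)
  with * show "\<exists>e \<in> o[at_right 0](\<lambda>r. 1 / ln (1 / r)). \<forall>\<^sub>F r in at_right 0.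
        f_scaled m lam f1 r powr (1 - m) =
          2 * (real n - 1) * (real n - 2 - real n * m) / ((1 - m) * \<bar>\<beta>\<bar> * r\<^sup>2) *
          (ln (1 / r)
           + (real n - 2 - (real n + 2) * m) / (2 * (real n - 2 - real n * m)) * ln (ln (1 / r))
           + K0 n m - ln lam
           + m / (real n - 2 - real n * m) * ln \<bar>\<beta>\<bar>
           + a3 n m (lam powr (- gamma1 n m)) \<beta>t / ln (1 / r)
           + (real n - 2 - (real n + 2) * m)\<^sup>2 / (4 * (real n - 2 - real n * m)\<^sup>2)
               * (ln (ln (1 / r)) / ln (1 / r))
           + e r)"
    using \<open>lam > 0\<close> by (simp add: \<open>\<beta>t = - \<beta>\<close>)
qed

end
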